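(* Let $T:[0,1]\to[0,1]$ be a map with a neutral fixed point at $0$ as described in the context, with parameters $\alpha\in(0,1)$, $x_0\in(0,1)$, $\beta>1$ and function $\delta_0$. Let $\Delta=[x_0,1]$, $|\Delta|=1-x_0$, let $\hat T$ be the induced map on $\Delta$, $\hat f$ its invariant density, $\hat f_m$ the invariant density of the discretized operator $\mathbb P_m=Q_m\circ\hat{\mathcal L}$, $f^*$ the $T$-invariant density and $f_m$ its approximation (all defined in the context). Let $\gamma<1$, $C_{LY}>0$ and $\hat C$ be constants, with $\hat C$ computable and independent of $m$, such that $1/|\hat T'|\le\gamma$, such that $V_\Delta\hat{\mathcal L}f\le\gamma V_\Delta f+C_{LY}\|f\|_{1,\Delta}$ for all $f\in BV(\Delta)$, and such that $\|\hat f-\hat f_m\|_\infty\le\hat C\frac{\ln m}{m}$ for any $m\in\mathbb N$. Then for any $m\in\mathbb N$ $$\|f^*-f_m\|_{\mathcal B}:=\sup_{x\in(0,1]}\left|x^{1+\alpha}\bigl(f^*(x)-f_m(x)\bigr)\right|\le C^*\,\frac{\ln m}{m},$$ where $$C^*=\hat C\left(1+\frac{x_0^{1+\alpha}}{\beta}+M(1+\alpha)\right)C_4,\qquad M=\frac{C_1^{1+\alpha}e^{2C_0C_1^{2\alpha}}}{\beta},$$ $$C_0=\frac{\alpha(1+\alpha)}{2}\left[1+2\delta_0(x_0)+\delta_0(x_0)^2\right],\qquad C_1=\left(2[2^{1/\alpha}-1]\right)^{1/\alpha},$$ $$C_4=1+C_3\left(\frac{C_{LY}}{1-\gamma}+\frac1{|\Delta|}\right),\qquad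 C_3=\frac1\beta+\frac{C_2}{\beta|\Delta|}\left(\alpha+\frac{2-\alpha}{1-\alpha}\right),$$ $$C_2=\frac{1-x_0}{x_0^{1+\alpha}}\,2^{1+\frac1\alpha}\left[2^{\frac1\alpha}-1\right]^{1+\frac1\alpha}.$$
   Context: Let $\lambda$ be Lebesgue measure on $I=[0,1]$. The map $T:I\to I$. There are $\alpha\in(0,1)$, $x_0\in(0,1)$ and $\beta>1$ such that: $T(0)=0$; with $T_1=T|_{[0,x_0)}$ and $T_2=T|_{[x_0,1]}$, $T_1$ maps $[0,x_0)$ onto $[0,1)$ and $T_2$ maps $[x_0,1]$ onto $[0,1]$; $T_1$ (extended to $x_0$) is $C^1$ on $[0,x_0]$ and $C^2$ on $(0,x_0]$; $T_2$ is $C^2$ on $[x_0,1]$; $T'(0)=1$, $T'(x)>1$ for $x\in(0,x_0)$, and $|T'(x)|\ge\beta>1$ for $x\in(x_0,1)$; finally $$T_1(x)=x+x^{1+\alpha}+x^{1+\alpha}\delta_0(x),\qquad T_1'(x)=1+(1+\alpha)x^\alpha+x^\alpha\delta_1(x),$$ where $\delta_i(x)\to0$ as $x\to0$ for $i=0,1$, and $\delta_0'(x)\ge0$. Induced map. $\Delta=[x_0,1]$, $|\Delta|=1-x_0$, and $\hat\lambda=\lambda/|\Delta|$ is normalized Lebesgue measure on $\Delta$. For $n\ge0$ let $x_{n+1}=T_1^{-1}(x_n)$; $W_0=(x_0,1)$, $W_n=(x_n,x_{n-1})$ for $n\ge1$; $Z_n=T_2^{-1}(W_{n-1})$ for $n\ge1$.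 Define $\hat T(x)=T^n(x)$ for $x\in Z_n$; $\tau_{Z_n}=n$ is the first return time of $Z_n$ to $\Delta$. Its transfer operator is $\hat{\mathcal L}f(x)=\sum_{y\in\hat T^{-1}x}f(y)/|\hat T'(y)|$. $V_\Delta$ denotes total variation over $\Delta$, $\|\cdot\|_{1,\Delta}$ the $L^1$ norm on $\Delta$ with respect to $\lambda$, $BV(\Delta)$ the functions of bounded variation on $\Delta$, and $\|\cdot\|_\infty$ the sup norm on $\Delta$. Facts the source quotes as known: each $\hat T|_{Z_n}$ is monotone, $C^2$, extends to a $C^2$ function on $\overline{Z_n}$ and is onto $\Delta$ (up to endpoints); $\sup_n\sup_{x\in Z_n}|\hat T''(x)|/(\hat T'(x))^2<\infty$; there is $\gamma<1$ with $1/|\hat T'|\le\gamma$; $\hat T$ has a unique invariant density $\hat f$ with respect to $\hat\lambda$ ($\hat{\mathcal L}\hat f=\hat f$, $\hat f\ge0$, $\int_\Delta\hat f\,d\hat\lambda=1$), taken in its Lipschitz continuous version; constants $C_{LY}$ and $\hat C$ as in the claim are available from earlier results. Discretization. Let $c_i=x_0+i|\Delta|/m$, $i=0,\dots,m$, $I_i=[c_{i-1},c_i]$, and let $\psi_0,\dots,\psi_m$ be the hat functions: $\psi_i$ is continuous on $\Delta$, affine on each $I_j$, with $\psi_i(c_j)=1$ if $i=j$ and $0$ otherwise. For $f\in L^1(\Delta)$ put $f_i=\frac m{|\Delta|}\int_{I_i}f\,d\lambda$ and $$Q_mf=f_1\psi_0+\sum_{i=1}^{m-1}\frac{f_i+f_{i+1}}2\psi_i+f_m\psi_m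 .$$ Let $\mathbb P_m=Q_m\circ\hat{\mathcal L}$, and let $\hat f_m$ be its invariant density: $\hat f_m\ge0$, $\mathbb P_m\hat f_m=\hat f_m$, $\int_\Delta\hat f_m\,d\hat\lambda=1$. The functions on $I$. Let $\hat\mu=\hat f\cdot\hat\lambda$, $\hat\mu_m=\hat f_m\cdot\hat\lambda$, $c_\tau^{-1}=\sum_{k\ge1}\tau_{Z_k}\hat\mu(Z_k)$, $c_{\tau,m}^{-1}=\sum_{k\ge1}\tau_{Z_k}\hat\mu_m(Z_k)$. The unique $T$-invariant density $f^*$ is taken in the form and with the normalization given by $$f^*(x)=c_\tau\hat f(x)\ (x\in\Delta),\qquad f^*(x)=c_\tau\sum_{n=1}^\infty\frac{\hat f(T_2^{-1}T_1^{-(n-1)}x)}{|DT^{(n)}(T_2^{-1}T_1^{-(n-1)}x)|}\ (x\in I\setminus\Delta),$$ and $f_m$ is defined by $$f_m(x)=c_{\tau,m}\hat f_m(x)\ (x\in\Delta),\qquad f_m(x)=c_{\tau,m}\sum_{n=1}^\infty\frac{\hat f_m(T_2^{-1}T_1^{-(n-1)}x)}{|DT^{(n)}(T_2^{-1}T_1^{-(n-1)}x)|}\ (x\in I\setminus\Delta),$$ where $DT^{(n)}$ is the derivative of the $n$-th iterate $T^n$ (computed along the branches $T_1^{n-1}\circ T_2$). $\mathcal B$ is the space of continuous functions on $(0,1]$ with norm $\|f\|_{\mathcal B}=\sup_{x\in(0,1]}|x^{1+\alpha}f(x)|$. *)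

theory Defs
  imports "HOL-Analysis.Analysis"
begin

subsection \<open>The map\<close>

text \<open>Derivatives are taken within the set, hence one-sided at end points belonging to it.\<close>

definition C1_on :: "(real \<Rightarrow> real) \<Rightarrow> real set \<Rightarrow> bool" where
  "C1_on f S \<longleftrightarrow>
     (\<exists>f'. (\<forall>x\<in>S. (f has_real_derivative f' x) (at x within S)) \<and> continuous_on S f')"

definition C2_on :: "(real \<Rightarrow> real) \<Rightarrow> real set \<Rightarrow> bool" where
  "C2_on f S \<longleftrightarrow>
     (\<exists>f'. (\<forall>x\<in>S. (f has_real_derivative f' x) (at x within S)) \<and> C1_on f' S)"

text \<open>
  The parameter \<open>T1\<close> is the first branch of \<open>T\<close> together with its extension to the end point \<open>x0\<close>,
  where \<open>T\<close> itself follows the second branch. In particular \<open>\<delta>0 x0\<close> is determined by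
  \<open>T1 x0\<close> (which is 1), not by \<open>T x0\<close>.
\<close>

locale neutral_map =
  fixes \<alpha> x0 \<beta> :: real and T T1 \<delta>0 \<delta>1 :: "real \<Rightarrow> real"
  assumes alpha: "0 < \<alpha>" "\<alpha> < 1"
    and x0: "0 < x0" "x0 < 1"
    and beta: "1 < \<beta>"
    and T_0: "T 0 = 0"
    and T_onto_left: "T ` {0..<x0} = {0..<1}"
    and T_onto_right: "T ` {x0..1} = {0..1}"
    and T1_eq: "\<And>x. x \<in> {0..<x0} \<Longrightarrow> T1 x = T x"
    and T1_C1: "C1_on T1 {0..x0}"
    and T1_C2: "C2_on T1 {0<..x0}"
    and T2_C2: "C2_on T {x0..1}"
    and T_deriv_0: "(T1 has_real_derivative 1) (at 0 within {0..x0})"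
    and T_deriv_left: "\<And>x. x \<in> {0<..<x0} \<Longrightarrow> deriv T x > 1"
    and T_deriv_right: "\<And>x. x \<in> {x0<..<1} \<Longrightarrow> \<bar>deriv T x\<bar> \<ge> \<beta>"
    and T1_expansion: "\<And>x. x \<in> {0..x0} \<Longrightarrow>
          T1 x = x + x powr (1 + \<alpha>) + x powr (1 + \<alpha>) * \<delta>0 x"
    and T1_deriv_expansion: "\<And>x. x \<in> {0<..x0} \<Longrightarrow>
          (T1 has_real_derivative 1 + (1 + \<alpha>) * x powr \<alpha> + x powr \<alpha> * \<delta>1 x)
            (at x within {0..x0})"
    and delta0_lim: "(\<delta>0 \<longlongrightarrow> 0) (at_right 0)"
    and delta1_lim: "(\<delta>1 \<longlongrightarrow> 0) (at_right 0)"
    and delta0_deriv: "\<And>x. x \<in> {0<..<x0} \<Longrightarrow> deriv \<delta>0 x \<ge> 0"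


subsection \<open>The induced map\<close>

abbreviation Delta :: "real \<Rightarrow> real set" where
  "Delta x0 \<equiv> {x0..1}"

definition T1_inv :: "real \<Rightarrow> (real \<Rightarrow> real) \<Rightarrow> real \<Rightarrow> real" where
  "T1_inv x0 T = inv_into {0..<x0} T"

definition T2_inv :: "real \<Rightarrow> (real \<Rightarrow> real) \<Rightarrow> real \<Rightarrow> real" where
  "T2_inv x0 T = inv_into {x0..1} T"

definition x_seq :: "real \<Rightarrow> (real \<Rightarrow> real) \<Rightarrow> nat \<Rightarrow> real" where
  "x_seq x0 T n = (T1_inv x0 T ^^ n) x0"

definition W :: "real \<Rightarrow> (real \<Rightarrow> real) \<Rightarrow> nat \<Rightarrow> real set" where
  "W x0 T n = (if n = 0 then {x0<..<1} else {x_seq x0 T n<..<x_seq x0 T (n - 1)})"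

definition Z :: "real \<Rightarrow> (real \<Rightarrow> real) \<Rightarrow> nat \<Rightarrow> real set" where
  "Z x0 T n = {y \<in> {x0..1}. T y \<in> W x0 T (n - 1)}"

text \<open>
  The induced map lives on \<open>hat_dom\<close>, which is \<open>Delta x0\<close> up to a countable set; the sets \<open>Z n\<close>,
  \<open>n \<ge> 1\<close>, are open and pairwise disjoint.
\<close>

definition hat_dom :: "real \<Rightarrow> (real \<Rightarrow> real) \<Rightarrow> real set" where
  "hat_dom x0 T = (\<Union>n\<in>{1..}. Z x0 T n)"

definition hat_T :: "real \<Rightarrow> (real \<Rightarrow> real) \<Rightarrow> real \<Rightarrow> real" where
  "hat_T x0 T x = (T ^^ (THE n. 1 \<le> n \<and> x \<in> Z x0 T n)) x"

definition hat_L :: "real \<Rightarrow> (real \<Rightarrow> real) \<Rightarrow> (real \<Rightarrow> real) \<Rightarrow> real \<Rightarrow> real" where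
  "hat_L x0 T f x =
     (\<Sum>\<^sub>\<infinity>y\<in>{y \<in> hat_dom x0 T. hat_T x0 T y = x}. f y / \<bar>deriv (hat_T x0 T) y\<bar>)"

definition hat_lambda :: "real \<Rightarrow> real measure" where
  "hat_lambda x0 = uniform_measure (lebesgue_on (Delta x0)) (Delta x0)"


subsection \<open>Norms and variation\<close>

text \<open>Suprema are taken in the extended reals, so that a bound also asserts boundedness.\<close>

definition sup_norm_on :: "real set \<Rightarrow> (real \<Rightarrow> real) \<Rightarrow> ereal" where
  "sup_norm_on S f = (SUP x\<in>S. ereal \<bar>f x\<bar>)"

definition B_norm :: "real \<Rightarrow> (real \<Rightarrow> real) \<Rightarrow> ereal" where
  "B_norm \<alpha> f = (SUP x\<in>{0<..1}. ereal \<bar>x powr (1 + \<alpha>) * f x\<bar>)"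

definition L1_norm_on :: "real set \<Rightarrow> (real \<Rightarrow> real) \<Rightarrow> real" where
  "L1_norm_on S f = (LINT x:S|lebesgue. \<bar>f x\<bar>)"

definition pointwise_variation :: "real set \<Rightarrow> (real \<Rightarrow> real) \<Rightarrow> ereal" where
  "pointwise_variation S f =
     (SUP xs\<in>{xs. sorted xs \<and> set xs \<subseteq> S}.
        ereal (\<Sum>i<length xs - 1. \<bar>f (xs ! Suc i) - f (xs ! i)\<bar>))"

text \<open>
  The transfer operator acts on classes of functions modulo null sets (its pointwise formula is an
  empty sum at the end points of \<open>Delta x0\<close>, where \<open>hat_T\<close> has no preimages), so variation is
  understood as that of a best representative of the class.
\<close>

definition variation_on :: "real set \<Rightarrow> (real \<Rightarrow> real) \<Rightarrow> ereal" where
  "variation_on S f = (INF g\<in>{g. AE x in lebesgue_on S. g x = f x}. pointwise_variation S g)"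

definition BV_on :: "real set \<Rightarrow> (real \<Rightarrow> real) set" where
  "BV_on S = {f. variation_on S f < \<infinity>}"


subsection \<open>The discretization\<close>

definition node :: "real \<Rightarrow> nat \<Rightarrow> nat \<Rightarrow> real" where
  "node x0 m i = x0 + real i * (1 - x0) / real m"

definition hat_fun :: "real \<Rightarrow> nat \<Rightarrow> nat \<Rightarrow> real \<Rightarrow> real" where
  "hat_fun x0 m i x = max 0 (1 - real m / (1 - x0) * \<bar>x - node x0 m i\<bar>)"

definition cell_mean :: "real \<Rightarrow> nat \<Rightarrow> (real \<Rightarrow> real) \<Rightarrow> nat \<Rightarrow> real" where
  "cell_mean x0 m f i =
     real m / (1 - x0) * (LINT x:{node x0 m (i - 1)..node x0 m i}|lebesgue. f x)"

definition Q :: "real \<Rightarrow> nat \<Rightarrow> (real \<Rightarrow> real) \<Rightarrow> real \<Rightarrow> real" where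
  "Q x0 m f x =
     cell_mean x0 m f 1 * hat_fun x0 m 0 x
     + (\<Sum>i=1..m - 1. (cell_mean x0 m f i + cell_mean x0 m f (i + 1)) / 2 * hat_fun x0 m i x)
     + cell_mean x0 m f m * hat_fun x0 m m x"

definition P_op :: "real \<Rightarrow> (real \<Rightarrow> real) \<Rightarrow> nat \<Rightarrow> (real \<Rightarrow> real) \<Rightarrow> real \<Rightarrow> real" where
  "P_op x0 T m f = Q x0 m (hat_L x0 T f)"

text \<open>The three properties that characterize the hat functions.\<close>

lemma hat_fun_continuous: "continuous_on S (hat_fun x0 m i)"
  unfolding hat_fun_def by (intro continuous_intros)

lemma hat_fun_node:
  assumes "x0 < 1" "1 \<le> m"
  shows "hat_fun x0 m i (node x0 m j) = (if i = j then 1 else 0)"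
proof -
  have "node x0 m j - node x0 m i = (real j - real i) * ((1 - x0) / real m)"
    by (simp add: node_def algebra_simps diff_divide_distrib)
  then have "real m / (1 - x0) * \<bar>node x0 m j - node x0 m i\<bar> = \<bar>real j - real i\<bar>"
    using assms by (simp add: abs_mult)
  moreover have "\<bar>real j - real i\<bar> \<ge> 1" if "i \<noteq> j"
    using that by linarith
  ultimately show ?thesis
    by (auto simp: hat_fun_def)
qed

lemma hat_fun_affine:
  assumes "x0 < 1" "1 \<le> m" "1 \<le> j"
  shows "\<exists>a b. \<forall>x\<in>{node x0 m (j - 1)..node x0 m j}. hat_fun x0 m i x = a + b * x"
proof -
  define h where "h = (1 - x0) / real m"
  have h: "h > 0" "real m / (1 - x0) = 1 / h"
    using assms by (auto simp: h_def)
  have n: "node x0 m k = x0 + real k * h" for k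
    by (simp add: node_def h_def)
  have f: "hat_fun x0 m i x = max 0 (1 - \<bar>x - node x0 m i\<bar> / h)" for x
    by (simp add: hat_fun_def h(2))
  have mono: "node x0 m k \<le> node x0 m l" if "k \<le> l" for k l
    using that h by (simp add: n mult_right_mono)
  consider "j + 1 \<le> i" | "j = i" | "j = i + 1" | "i + 2 \<le> j" by linarith
  then show ?thesis
  proof cases
    case 1
    have "hat_fun x0 m i x = 0 + 0 * x" if "x \<in> {node x0 m (j - 1)..node x0 m j}" for x
    proof -
      have "x \<le> node x0 m (i - 1)" using order_trans[OF _ mono[of j "i - 1"]] that 1 by simp
      moreover have "node x0 m i = node x0 m (i - 1) + h"
        using 1 by (simp add: n of_nat_diff algebra_simps)
      ultimately have "\<bar>x - node x0 m i\<bar> / h \<ge> 1" using h by (simp add: field_simps)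
      then show ?thesis by (simp add: f)
    qed
    then show ?thesis by blast
  next
    case 2
    have "hat_fun x0 m i x = (1 - node x0 m i / h) + (1 / h) * x"
      if "x \<in> {node x0 m (j - 1)..node x0 m j}" for x
    proof -
      have "node x0 m i = node x0 m (j - 1) + h"
        using 2 assms by (simp add: n of_nat_diff algebra_simps)
      then have "\<bar>x - node x0 m i\<bar> = node x0 m i - x" "\<bar>x - node x0 m i\<bar> / h \<le> 1"
        using that h 2 by (auto simp: field_simps)
      then show ?thesis using h by (simp add: f field_simps)
    qed
    then show ?thesis by blast
  next
    case 3
    have "hat_fun x0 m i x = (1 + node x0 m i / h) + (- 1 / h) * x"
      if "x \<in> {node x0 m (j - 1)..node x0 m j}" for x
    proof -
      have "node x0 m j = node x0 m i + h" using 3 by (simp add: n algebra_simps)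
      then have "\<bar>x - node x0 m i\<bar> = x - node x0 m i" "\<bar>x - node x0 m i\<bar> / h \<le> 1"
        using that h 3 by (auto simp: field_simps)
      then show ?thesis using h by (simp add: f field_simps)
    qed
    then show ?thesis by blast
  next
    case 4
    have "hat_fun x0 m i x = 0 + 0 * x" if "x \<in> {node x0 m (j - 1)..node x0 m j}" for x
    proof -
      have "node x0 m (i + 1) \<le> x" using order_trans[OF mono[of "i + 1" "j - 1"]] that 4 by simp
      moreover have "node x0 m (i + 1) = node x0 m i + h" by (simp add: n algebra_simps)
      ultimately have "\<bar>x - node x0 m i\<bar> / h \<ge> 1" using h by (simp add: field_simps)
      then show ?thesis by (simp add: f)
    qed
    then show ?thesis by blast
  qed
qed


subsection \<open>Densities\<close>

definition hat_invariant_density :: "real \<Rightarrow> (real \<Rightarrow> real) \<Rightarrow> (real \<Rightarrow> real) \<Rightarrow> bool" where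
  "hat_invariant_density x0 T f \<longleftrightarrow>
     (\<forall>x\<in>Delta x0. 0 \<le> f x) \<and>
     (AE x in hat_lambda x0. hat_L x0 T f x = f x) \<and>
     (LINT x|hat_lambda x0. f x) = 1"

text \<open>
  Values of \<open>P_op\<close> are continuous functions on \<open>Delta x0\<close>, so its fixed points are required to
  agree with their images everywhere.
\<close>

definition discrete_invariant_density ::
    "real \<Rightarrow> (real \<Rightarrow> real) \<Rightarrow> nat \<Rightarrow> (real \<Rightarrow> real) \<Rightarrow> bool" where
  "discrete_invariant_density x0 T m f \<longleftrightarrow>
     (\<forall>x\<in>Delta x0. 0 \<le> f x) \<and>
     (\<forall>x\<in>Delta x0. P_op x0 T m f x = f x) \<and>
     (LINT x|hat_lambda x0. f x) = 1"

definition hat_mu :: "real \<Rightarrow> (real \<Rightarrow> real) \<Rightarrow> real measure" where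
  "hat_mu x0 f = density (hat_lambda x0) (\<lambda>x. ennreal (f x))"

text \<open>The factor \<open>k\<close> is the first return time of \<open>Z k\<close> to \<open>Delta x0\<close>.\<close>

definition c_tau :: "real \<Rightarrow> (real \<Rightarrow> real) \<Rightarrow> (real \<Rightarrow> real) \<Rightarrow> real" where
  "c_tau x0 T f = inverse (\<Sum>\<^sub>\<infinity>k\<in>{1..}. real k * measure (hat_mu x0 f) (Z x0 T k))"

text \<open>
  The density on the unit interval obtained from a density \<open>f\<close> on \<open>Delta x0\<close>. For \<open>0 < x < x0\<close>
  the orbit of the point at which \<open>T ^^ n\<close> is differentiated stays in the open branches before
  reaching \<open>x\<close>, so \<open>deriv\<close> computes the derivative along the branches.
\<close>

definition full_density :: "real \<Rightarrow> (real \<Rightarrow> real) \<Rightarrow> (real \<Rightarrow> real) \<Rightarrow> real \<Rightarrow> real" where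
  "full_density x0 T f x =
     (if x \<in> Delta x0 then c_tau x0 T f * f x
      else c_tau x0 T f *
        (\<Sum>\<^sub>\<infinity>n\<in>{1..}.
           f (T2_inv x0 T ((T1_inv x0 T ^^ (n - 1)) x)) /
           \<bar>deriv (T ^^ n) (T2_inv x0 T ((T1_inv x0 T ^^ (n - 1)) x))\<bar>))"


subsection \<open>The constants\<close>

text \<open>The parameter \<open>d\<close> stands for \<open>\<delta>0 x0\<close>.\<close>

definition const_C0 :: "real \<Rightarrow> real \<Rightarrow> real" where
  "const_C0 \<alpha> d = \<alpha> * (1 + \<alpha>) / 2 * (1 + 2 * d + d\<^sup>2)"

definition const_C1 :: "real \<Rightarrow> real" where
  "const_C1 \<alpha> = (2 * (2 powr (1 / \<alpha>) - 1)) powr (1 / \<alpha>)"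

definition const_M :: "real \<Rightarrow> real \<Rightarrow> real \<Rightarrow> real" where
  "const_M \<alpha> \<beta> d =
     const_C1 \<alpha> powr (1 + \<alpha>) * exp (2 * const_C0 \<alpha> d * const_C1 \<alpha> powr (2 * \<alpha>)) / \<beta>"

definition const_C2 :: "real \<Rightarrow> real \<Rightarrow> real" where
  "const_C2 \<alpha> x0 =
     (1 - x0) / x0 powr (1 + \<alpha>) * 2 powr (1 + 1 / \<alpha>) * (2 powr (1 / \<alpha>) - 1) powr (1 + 1 / \<alpha>)"

definition const_C3 :: "real \<Rightarrow> real \<Rightarrow> real \<Rightarrow> real" where
  "const_C3 \<alpha> x0 \<beta> =
     1 / \<beta> + const_C2 \<alpha> x0 / (\<beta> * (1 - x0)) * (\<alpha> + (2 - \<alpha>) / (1 - \<alpha>))"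

definition const_C4 :: "real \<Rightarrow> real \<Rightarrow> real \<Rightarrow> real \<Rightarrow> real \<Rightarrow> real" where
  "const_C4 \<alpha> x0 \<beta> \<gamma> C\<^sub>L\<^sub>Y = 1 + const_C3 \<alpha> x0 \<beta> * (C\<^sub>L\<^sub>Y / (1 - \<gamma>) + 1 / (1 - x0))"

definition const_C_star ::
    "real \<Rightarrow> real \<Rightarrow> real \<Rightarrow> real \<Rightarrow> real \<Rightarrow> real \<Rightarrow> real \<Rightarrow> real" where
  "const_C_star \<alpha> x0 \<beta> d \<gamma> C\<^sub>L\<^sub>Y C_hat =
     C_hat * (1 + x0 powr (1 + \<alpha>) / \<beta> + const_M \<alpha> \<beta> d * (1 + \<alpha>)) * const_C4 \<alpha> x0 \<beta> \<gamma> C\<^sub>L\<^sub>Y"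

end

theory Submission
  imports Defs
begin

text \<open>
  Pulling \<open>x > 0\<close> back along the first branch gives points \<open>z\<^sub>k\<close> with
  \<open>z\<^sub>k \<le> const_C1 \<alpha> * k powr - (1 / \<alpha>)\<close>, because \<open>T\<close> pushes points away from 0 at least
  as fast as \<open>x + x powr (1 + \<alpha>)\<close>. Along such an orbit the derivative of \<open>T ^^ k\<close> dominates \<open>(x / z\<^sub>k) powr (1 + \<alpha>)\<close> up to a factor whose
  logarithm is a convergent sum of \<open>z\<^sub>k powr (2 * \<alpha>)\<close>; hence the weight \<open>x powr (1 + \<alpha>)\<close> makes the
  series defining the density on \<open>{0<..<x0}\<close> summable uniformly in \<open>x\<close>. The same decay bounds the
  mean return time with respect to Lebesgue measure, so the normalizing constants \<open>c_tau\<close> depend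
  Lipschitz continuously on the induced density in the sup norm. The Lasota-Yorke inequality, applied
  to the fixed point \<open>f_hat\<close>, bounds its variation and thereby its supremum.
\<close>

section \<open>Powers and infinite sums\<close>

text \<open>Discrete integral comparison: by the mean value theorem each term after the first is at
  most an increment of an antiderivative of \<open>z powr - s\<close>, and the increments
  telescope.\<close>

lemma sum_powr_le:
  fixes s :: real
  assumes s: "1 < s"
  shows "(\<Sum>k=1..N. real k powr - s) \<le> 1 + 1 / (s - 1)"
proof -
  have step: "real (Suc n) powr - s \<le> (real n powr (1 - s) - real (Suc n) powr (1 - s)) / (s - 1)"
    if n: "1 \<le> n" for n
  proof -
    have "\<exists>z. real n < z \<and> z < real (Suc n) \<and>
      real (Suc n) powr (1 - s) - real n powr (1 - s) =
        (real (Suc n) - real n) * ((1 - s) * z powr - s)"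
    proof (rule MVT2)
      fix x assume "real n \<le> x"
      with n have "x > 0" by linarith
      then show "((\<lambda>x. x powr (1 - s)) has_real_derivative (1 - s) * x powr - s) (at x)"
        by (auto intro!: derivative_eq_intros)
    qed simp
    then obtain z where z: "real n < z" "z < real (Suc n)"
      and eq: "real (Suc n) powr (1 - s) - real n powr (1 - s) = (1 - s) * z powr - s"
      by auto
    have "real (Suc n) powr - s \<le> z powr - s"
      using z s n by (intro powr_mono2') auto
    moreover have "(real n powr (1 - s) - real (Suc n) powr (1 - s)) / (s - 1) = z powr - s"
      using eq s by (simp add: field_simps)
    ultimately show ?thesis by simp
  qed
  have "(\<Sum>k=1..Suc n. real k powr - s) \<le> 1 + (1 - real (Suc n) powr (1 - s)) / (s - 1)" for n
  proof (induction n)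
    case (Suc n)
    have "(\<Sum>k=1..Suc (Suc n). real k powr - s)
      = (\<Sum>k=1..Suc n. real k powr - s) + real (Suc (Suc n)) powr - s" by simp
    also have "\<dots> \<le> 1 + (1 - real (Suc n) powr (1 - s)) / (s - 1)
        + (real (Suc n) powr (1 - s) - real (Suc (Suc n)) powr (1 - s)) / (s - 1)"
      by (intro add_mono Suc step) simp
    also have "\<dots> = 1 + (1 - real (Suc (Suc n)) powr (1 - s)) / (s - 1)"
      by (simp add: diff_divide_distrib)
    finally show ?case .
  qed simp
  moreover have "1 + (1 - real (Suc n) powr (1 - s)) / (s - 1) \<le> 1 + 1 / (s - 1)" for n
    using s by (intro add_left_mono divide_right_mono) auto
  ultimately have "(\<Sum>k=1..Suc n. real k powr - s) \<le> 1 + 1 / (s - 1)" for n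
    by (meson order_trans)
  then show ?thesis
    using s by (cases N) auto
qed

text \<open>Weighted arithmetic-geometric mean inequality for \<open>1 + u\<close> and 1 with
  weights \<open>a\<close> and \<open>1 - a\<close>.\<close>

lemma powr_Bernoulli:
  fixes u a :: real
  assumes "0 \<le> a" "a \<le> 1" "0 \<le> u"
  shows "(1 + u) powr a \<le> 1 + a * u"
proof -
  have "(1 + u) powr a * 1 powr (1 - a) \<le> a * (1 + u) + (1 - a) * 1"
    using assms by (intro Youngs_inequality_0) auto
  then show ?thesis by (simp add: algebra_simps)
qed

text \<open>The gap between the two sides vanishes at 0, and its derivative is \<open>1 + a\<close>
  times the gap in \<open>powr_Bernoulli\<close>.\<close>

lemma powr_one_plus_Taylor:
  fixes u a :: real
  assumes "0 \<le> a" "a \<le> 1" "0 \<le> u"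
  shows "(1 + u) powr (1 + a) \<le> 1 + (1 + a) * u + a * (1 + a) / 2 * u\<^sup>2"
proof -
  define h where "h = (\<lambda>u. 1 + (1 + a) * u + a * (1 + a) / 2 * u\<^sup>2 - (1 + u) powr (1 + a))"
  have "h 0 \<le> h u"
  proof (rule DERIV_nonneg_imp_nondecreasing[OF \<open>0 \<le> u\<close>])
    fix x :: real assume x: "0 \<le> x"
    have "(h has_real_derivative (1 + a) * (1 + a * x - (1 + x) powr a)) (at x)"
      unfolding h_def using x
      by (auto intro!: derivative_eq_intros simp: algebra_simps)
    moreover have "(1 + a) * (1 + a * x - (1 + x) powr a) \<ge> 0"
      using powr_Bernoulli[of a x] assms x by simp
    ultimately show "\<exists>y. (h has_real_derivative y) (at x) \<and> 0 \<le> y" by blast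
  qed
  then show ?thesis by (simp add: h_def)
qed

text \<open>Convexity: between 1 and 2 the power function lies below its chord, read off at
  \<open>1 + 1 / real n\<close>.\<close>

lemma powr_one_plus_inverse_le:
  fixes p :: real
  assumes p: "1 \<le> p" and n: "1 \<le> n"
  shows "(1 + 1 / real n) powr p \<le> 1 + (2 powr p - 1) / real n"
proof -
  have "((1 - 1 / real n) *\<^sub>R 1 + (1 / real n) *\<^sub>R 2) powr p
    \<le> (1 - 1 / real n) * 1 powr p + 1 / real n * 2 powr p"
    using n by (intro convex_onD[OF powr_convex[OF p]]) auto
  also have "(1 - 1 / real n) *\<^sub>R 1 + (1 / real n) *\<^sub>R 2 = 1 + 1 / real n"
    by simp
  also have "(1 - 1 / real n) * 1 powr p + 1 / real n * 2 powr p = 1 + (2 powr p - 1) / real n"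
    by (simp add: diff_divide_distrib)
  finally show ?thesis .
qed

lemma nonneg_infsum_atLeast_1:
  fixes g :: "nat \<Rightarrow> real"
  assumes nonneg: "\<And>n. 1 \<le> n \<Longrightarrow> 0 \<le> g n" and bound: "\<And>N. (\<Sum>n=1..N. g n) \<le> B"
  shows "g summable_on {1..}" "infsum g {1..} \<le> B"
proof -
  have F: "sum g F \<le> B" if "finite F" "F \<subseteq> {1..}" for F
  proof -
    \<comment> \<open>Inserting 0 gives \<open>Max\<close> a value when \<open>F\<close> is
      empty.\<close>
    have "F \<subseteq> {1..Max (insert 0 F)}"
      using that by auto
    then have "sum g F \<le> sum g {1..Max (insert 0 F)}"
      by (intro sum_mono2) (auto intro: nonneg)
    also have "\<dots> \<le> B" by (rule bound)
    finally show ?thesis .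
  qed
  show sg: "g summable_on {1..}"
    by (intro nonneg_bdd_above_summable_on bdd_aboveI2[of _ _ B]) (use F nonneg in auto)
  then show "infsum g {1..} \<le> B"
    by (rule infsum_le_finite_sums) (use F in auto)
qed

lemma abs_infsum_le:
  fixes u g :: "'a \<Rightarrow> real"
  assumes g: "g summable_on A" and le: "\<And>n. n \<in> A \<Longrightarrow> \<bar>u n\<bar> \<le> g n"
  shows "u summable_on A" "\<bar>infsum u A\<bar> \<le> infsum g A"
proof -
  have abs: "(\<lambda>n. norm (u n)) summable_on A"
    by (rule summable_on_comparison_test[OF g]) (simp_all add: le)
  then show "u summable_on A"
    by (rule abs_summable_summable)
  have "norm (infsum u A) \<le> (\<Sum>\<^sub>\<infinity>n\<in>A. norm (u n))"
    by (rule norm_infsum_bound[OF abs])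
  also have "\<dots> \<le> infsum g A"
    by (rule infsum_mono[OF abs g]) (simp add: le)
  finally show "\<bar>infsum u A\<bar> \<le> infsum g A" by simp
qed

lemma infsum_diff:
  fixes f g :: "'a \<Rightarrow> real"
  assumes "f summable_on A" "g summable_on A"
  shows "(\<Sum>\<^sub>\<infinity>x\<in>A. f x - g x) = infsum f A - infsum g A"
  using infsum_add[OF assms(1) summable_on_uminus[THEN iffD2, OF assms(2)]]
  by (simp add: infsum_uminus)

section \<open>Densities on the inducing set\<close>

text \<open>\<open>S\<close> lies between its infimum and supremum, which differ by at most
  \<open>d\<close>. Used for preimages under the expanding branch, whose shape then needs no
  analysis.\<close>

lemma measure_lebesgue_le_diameter:
  fixes S :: "real set"
  assumes S: "S \<in> sets lebesgue" and d: "\<And>x y. x \<in> S \<Longrightarrow> y \<in> S \<Longrightarrow> \<bar>x - y\<bar> \<le> d" and "0 \<le> d"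
  shows "measure lebesgue S \<le> d"
proof (cases "S = {}")
  case False
  then obtain z where z: "z \<in> S" by blast
  have bdd: "bdd_above S" "bdd_below S"
  proof -
    have near: "z - d \<le> y" "y \<le> z + d" if "y \<in> S" for y
      using d[OF z that] by linarith+
    show "bdd_above S" by (rule bdd_aboveI[of _ "z + d"]) (rule near)
    show "bdd_below S" by (rule bdd_belowI[of _ "z - d"]) (rule near)
  qed
  have "y - d \<le> Inf S" if "y \<in> S" for y
  proof (rule cInf_greatest[OF False])
    show "y - d \<le> x" if "x \<in> S" for x
      using d[OF \<open>y \<in> S\<close> that] by linarith
  qed
  then have "Sup S \<le> Inf S + d"
    using False by (intro cSup_least) (auto simp: diff_le_eq)
  have le: "Inf S \<le> Sup S"
    using cInf_lower[OF z bdd(2)] cSup_upper[OF z bdd(1)] by linarith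
  have "measure lebesgue S \<le> measure lebesgue {Inf S..Sup S}"
    using S bdd by (intro measure_mono_fmeasurable) (auto intro: cInf_lower cSup_upper)
  also have "\<dots> = Sup S - Inf S"
    using le by simp
  also have "\<dots> \<le> d"
    using \<open>Sup S \<le> Inf S + d\<close> by simp
  finally show ?thesis .
qed (simp add: \<open>0 \<le> d\<close>)

section \<open>Normalized Lebesgue measure and measures with continuous density\<close>

context
  fixes x0 :: real
  assumes less1: "x0 < 1"
begin

lemma sets_hat_lambda: "A \<in> sets (hat_lambda x0) \<longleftrightarrow> A \<subseteq> {x0..1} \<and> A \<in> sets lebesgue"
  by (simp add: hat_lambda_def sets_restrict_space_iff)

lemma space_hat_lambda: "space (hat_lambda x0) = {x0..1}"
  by (simp add: hat_lambda_def)

lemma emeasure_Delta: "emeasure (lebesgue_on {x0..1}) {x0..1} = ennreal (1 - x0)"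
  using less1 by (simp add: emeasure_restrict_space)

lemma measure_hat_lambda:
  assumes "A \<subseteq> {x0..1}" "A \<in> sets lebesgue"
  shows "measure (hat_lambda x0) A = measure lebesgue A / (1 - x0)"
  using assms less1 unfolding hat_lambda_def
  by (subst measure_uniform_measure)
     (auto simp: emeasure_Delta sets_restrict_space_iff measure_restrict_space Int_absorb1)

lemma measure_hat_lambda_Delta: "measure (hat_lambda x0) {x0..1} = 1"
  using less1 by (subst measure_hat_lambda) auto

lemma finite_measure_hat_lambda: "finite_measure (hat_lambda x0)"
proof (rule finite_measureI)
  show "emeasure (hat_lambda x0) (space (hat_lambda x0)) \<noteq> \<infinity>"
    using measure_hat_lambda_Delta by (auto simp: space_hat_lambda measure_def)
qed

lemma AE_hat_lambda: "(AE x in hat_lambda x0. P x) \<longleftrightarrow> (AE x in lebesgue_on {x0..1}. P x)"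
  using less1 unfolding hat_lambda_def
  by (subst AE_uniform_measure) (auto simp: emeasure_Delta AE_restrict_space_iff)

text \<open>Replaces the extended real quotient in \<open>uniform_measure\<close> by a real
  constant, the form in which \<open>integral_density\<close> applies.\<close>

lemma hat_lambda_eq_density:
  "hat_lambda x0 = density (lebesgue_on {x0..1}) (\<lambda>x. ennreal (1 / (1 - x0)))"
  unfolding hat_lambda_def uniform_measure_def emeasure_Delta
proof (rule density_cong)
  show "AE x in lebesgue_on {x0..1}. indicator {x0..1} x / ennreal (1 - x0) = ennreal (1 / (1 - x0))"
    using less1 by (intro AE_I2) (simp add: divide_ennreal flip: ennreal_1)
qed (auto intro!: borel_measurable_divide_ennreal borel_measurable_indicator)

lemma measurable_hat_lambda:
  assumes "continuous_on {x0..1} f"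
  shows "f \<in> borel_measurable (hat_lambda x0)"
  using continuous_imp_measurable_on_sets_lebesgue[OF assms] 
  by (simp add: hat_lambda_def measurable_def)

lemma L1_norm_on_Delta:
  assumes "continuous_on {x0..1} f" "\<forall>x\<in>{x0..1}. 0 \<le> f x"
  shows "L1_norm_on {x0..1} f = (1 - x0) * (LINT x|hat_lambda x0. f x)"
proof -
  have "L1_norm_on {x0..1} f = (LINT x|lebesgue_on {x0..1}. \<bar>f x\<bar>)"
    by (simp add: L1_norm_on_def set_lebesgue_integral_def integral_restrict_space)
  also have "\<dots> = (LINT x|lebesgue_on {x0..1}. f x)"
    using assms(2) by (intro Bochner_Integration.integral_cong) auto
  also have "(LINT x|hat_lambda x0. f x) = (LINT x|lebesgue_on {x0..1}. (1 / (1 - x0)) *\<^sub>R f x)"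
    unfolding hat_lambda_eq_density using less1
    by (intro integral_density continuous_imp_measurable_on_sets_lebesgue assms) auto
  ultimately show ?thesis
    using less1 by simp
qed

lemma integrable_hat_lambda:
  fixes f :: "real \<Rightarrow> real"
  assumes "continuous_on {x0..1} f"
  shows "integrable (hat_lambda x0) f"
proof -
  interpret finite_measure "hat_lambda x0" by (rule finite_measure_hat_lambda)
  have "compact (f ` {x0..1})"
    using assms by (intro compact_continuous_image) auto
  then obtain B where "\<And>x. x \<in> {x0..1} \<Longrightarrow> norm (f x) \<le> B"
    using compact_imp_bounded bounded_iff by (metis imageI)
  then show ?thesis
    using assms by (intro integrable_const_bound[where B = B] measurable_hat_lambda AE_I2)
      (auto simp: space_hat_lambda)
qed

lemma integrable_hat_lambda_indicator:
  fixes f :: "real \<Rightarrow> real"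
  assumes "continuous_on {x0..1} f" "A \<in> sets (hat_lambda x0)"
  shows "integrable (hat_lambda x0) (\<lambda>x. f x * indicator A x)"
  by (rule integrable_real_mult_indicator[OF assms(2) integrable_hat_lambda[OF assms(1)]])

lemma emeasure_hat_mu:
  assumes f: "continuous_on {x0..1} f" "\<forall>x\<in>{x0..1}. 0 \<le> f x"
    and A: "A \<in> sets (hat_lambda x0)"
  shows "emeasure (hat_mu x0 f) A = ennreal (LINT x|hat_lambda x0. f x * indicator A x)"
proof -
  have "emeasure (hat_mu x0 f) A = (\<integral>\<^sup>+ x. ennreal (f x) * indicator A x \<partial>hat_lambda x0)"
    unfolding hat_mu_def using f A
    by (intro emeasure_density measurable_compose[OF measurable_hat_lambda]) auto
  also have "\<dots> = (\<integral>\<^sup>+ x. ennreal (f x * indicator A x) \<partial>hat_lambda x0)"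
    by (intro nn_integral_cong) (auto split: split_indicator)
  also have "\<dots> = ennreal (LINT x|hat_lambda x0. f x * indicator A x)"
    using f A by (intro nn_integral_eq_integral integrable_hat_lambda_indicator AE_I2)
      (auto simp: space_hat_lambda)
  finally show ?thesis .
qed

lemma measure_hat_mu:
  assumes f: "continuous_on {x0..1} f" "\<forall>x\<in>{x0..1}. 0 \<le> f x"
    and A: "A \<in> sets (hat_lambda x0)"
  shows "measure (hat_mu x0 f) A = (LINT x|hat_lambda x0. f x * indicator A x)"
proof -
  have "0 \<le> (LINT x|hat_lambda x0. f x * indicator A x)"
    using f by (intro Bochner_Integration.integral_nonneg) (auto simp: space_hat_lambda)
  then show ?thesis
    by (simp add: measure_def emeasure_hat_mu[OF assms])
qed

lemma measure_hat_mu_diff: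
  assumes f: "continuous_on {x0..1} f" "\<forall>x\<in>{x0..1}. 0 \<le> f x"
    and g: "continuous_on {x0..1} g" "\<forall>x\<in>{x0..1}. 0 \<le> g x"
    and le: "\<And>x. x \<in> {x0..1} \<Longrightarrow> \<bar>f x - g x\<bar> \<le> \<epsilon>"
    and A: "A \<in> sets (hat_lambda x0)"
  shows "\<bar>measure (hat_mu x0 f) A - measure (hat_mu x0 g) A\<bar> \<le> \<epsilon> * measure (hat_lambda x0) A"
proof -
  have "measure (hat_mu x0 f) A - measure (hat_mu x0 g) A
     = (LINT x|hat_lambda x0. f x * indicator A x - g x * indicator A x)"
    by (simp add: measure_hat_mu[OF f A] measure_hat_mu[OF g A]
        integrable_hat_lambda_indicator[OF f(1) A] integrable_hat_lambda_indicator[OF g(1) A])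
  also have "\<bar>\<dots>\<bar> \<le> (LINT x|hat_lambda x0. \<bar>f x * indicator A x - g x * indicator A x\<bar>)"
    by (rule integral_abs_bound)
  also have "\<dots> \<le> (LINT x|hat_lambda x0. \<epsilon> * indicator A x)"
  proof (rule integral_mono)
    show "integrable (hat_lambda x0) (\<lambda>x. \<bar>f x * indicator A x - g x * indicator A x\<bar>)"
      using f g A by (intro integrable_abs Bochner_Integration.integrable_diff integrable_hat_lambda_indicator)
    show "integrable (hat_lambda x0) (\<lambda>x. \<epsilon> * indicator A x)"
      using A by (intro integrable_hat_lambda_indicator) auto
    show "\<bar>f x * indicator A x - g x * indicator A x\<bar> \<le> \<epsilon> * indicator A x"
      if "x \<in> space (hat_lambda x0)" for x
      using that le[of x] by (auto simp: space_hat_lambda split: split_indicator)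
  qed
  also have "\<dots> = \<epsilon> * measure (hat_lambda x0) A"
    using A by simp
  finally show ?thesis .
qed

end

section \<open>Variation and a supremum bound for the induced density\<close>

text \<open>A continuous function attains its values, up to small errors, at points where it agrees with
  any given representative of its class.\<close>

lemma diff_le_pointwise_variation:
  fixes f g :: "real \<Rightarrow> real"
  assumes f: "continuous_on {a..b} f" and ab: "a < b" and ae: "AE z in lebesgue_on {a..b}. g z = f z"
    and x: "x \<in> {a..b}" and y: "y \<in> {a..b}"
  shows "ereal (f x - f y) \<le> pointwise_variation {a..b} g"
proof (rule ereal_le_epsilon2)
  fix e :: real assume e: "0 < e"
  have good: "\<exists>x'\<in>{a..b}. g x' = f x' \<and> \<bar>f x' - f x\<bar> \<le> e / 2" if x: "x \<in> {a..b}" for x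
  proof -
    obtain d where d: "d > 0" "\<And>z. z \<in> {a..b} \<Longrightarrow> \<bar>z - x\<bar> < d \<Longrightarrow> \<bar>f z - f x\<bar> < e / 2"
      using f x e unfolding continuous_on_iff dist_real_def by (meson half_gt_zero)
    \<comment> \<open>Cutting the neighbourhood of \<open>x\<close> down to \<open>{a..b}\<close>
      leaves an interval of positive length even at an end point, since \<open>a < b\<close>; a null
      set cannot contain it.\<close>
    define l u where "l = max a (x - d)" and "u = min b (x + d)"
    have lu: "l < u" using x d(1) ab by (auto simp: l_def u_def)
    have "\<exists>z\<in>{l<..<u}. g z = f z"
    proof (rule ccontr)
      assume "\<not> ?thesis"
      then have no: "g z \<noteq> f z" if "z \<in> {l<..<u}" for z using that by blast
      have "AE z in lebesgue. z \<notin> {l<..<u}"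
        using ae[unfolded AE_restrict_space_iff[of "{a..b}" lebesgue, simplified]]
        by eventually_elim (use no in \<open>auto simp: l_def u_def\<close>)
      then have "{l<..<u} \<in> null_sets lebesgue"
        by (subst AE_iff_null_sets) auto
      then show False
        using lu by (simp add: null_sets_def)
    qed
    then obtain z where z: "z \<in> {l<..<u}" "g z = f z" by blast
    then have "z \<in> {a..b}" "\<bar>z - x\<bar> < d"
      by (auto simp: l_def u_def)
    then show ?thesis
      using d(2)[of z] z by force
  qed
  obtain x' where x': "x' \<in> {a..b}" "g x' = f x'" "\<bar>f x' - f x\<bar> \<le> e / 2"
    using good[OF x] by blast
  obtain y' where y': "y' \<in> {a..b}" "g y' = f y'" "\<bar>f y' - f y\<bar> \<le> e / 2"
    using good[OF y] by blast
  have "ereal \<bar>g x' - g y'\<bar> \<le> pointwise_variation {a..b} g"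
    unfolding pointwise_variation_def
  proof (rule SUP_upper2)
    \<comment> \<open>The order of the two points is unknown, so \<open>min\<close> and
      \<open>max\<close> sort the two-point partition.\<close>
    show "[min x' y', max x' y'] \<in> {xs. sorted xs \<and> set xs \<subseteq> {a..b}}"
      using x'(1) y'(1) by (simp add: min_def max_def)
    show "ereal \<bar>g x' - g y'\<bar> \<le> ereal (\<Sum>i<length [min x' y', max x' y'] - 1.
        \<bar>g ([min x' y', max x' y'] ! Suc i) - g ([min x' y', max x' y'] ! i)\<bar>)"
      by (simp add: min_def max_def abs_minus_commute)
  qed
  then have "ereal \<bar>g x' - g y'\<bar> + ereal e \<le> pointwise_variation {a..b} g + ereal e"
    by (rule add_right_mono)
  moreover have "f x - f y \<le> \<bar>g x' - g y'\<bar> + e"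
    using x' y' by linarith
  then have "ereal (f x - f y) \<le> ereal \<bar>g x' - g y'\<bar> + ereal e"
    by simp
  ultimately show "ereal (f x - f y) \<le> pointwise_variation {a..b} g + ereal e"
    by (rule order_trans[rotated])
qed

text \<open>\<open>f\<close> represents its own class, and the Lipschitz increments along a sorted
  list telescope. This provides the finiteness needed to rearrange the Lasota-Yorke
  inequality.\<close>

lemma variation_on_le_Lipschitz:
  assumes f: "L-lipschitz_on {a..b} f" and ab: "a \<le> b"
  shows "variation_on {a..b} f \<le> ereal (L * (b - a))"
proof -
  have "variation_on {a..b} f \<le> pointwise_variation {a..b} f"
    unfolding variation_on_def by (rule INF_lower) simp
  also have "\<dots> \<le> ereal (L * (b - a))"
    unfolding pointwise_variation_def
  proof (rule SUP_least)
    fix xs assume "xs \<in> {xs. sorted xs \<and> set xs \<subseteq> {a..b}}"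
    then have xs: "sorted xs" "\<And>i. i < length xs \<Longrightarrow> xs ! i \<in> {a..b}"
      using nth_mem by blast+
    have L: "0 \<le> L" using f by (rule lipschitz_on_nonneg)
    have "(\<Sum>i<length xs - 1. \<bar>f (xs ! Suc i) - f (xs ! i)\<bar>) \<le> (\<Sum>i<length xs - 1. L * (xs ! Suc i - xs ! i))"
    proof (rule sum_mono)
      fix i assume "i \<in> {..<length xs - 1}"
      then have i: "Suc i < length xs" by auto
      then have "xs ! i \<le> xs ! Suc i"
        using xs(1) by (simp add: sorted_nth_mono)
      then show "\<bar>f (xs ! Suc i) - f (xs ! i)\<bar> \<le> L * (xs ! Suc i - xs ! i)"
        using lipschitz_onD[OF f xs(2)[OF i] xs(2)[of i]] i by (simp add: dist_real_def)
    qed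
    also have "\<dots> = L * (xs ! (length xs - 1) - xs ! 0)"
      by (simp add: sum_lessThan_telescope flip: sum_distrib_left)
    also have "\<dots> \<le> L * (b - a)"
    proof (cases "xs = []")
      case False
      then have "xs ! (length xs - 1) \<in> {a..b}" "xs ! 0 \<in> {a..b}"
        by (intro xs; simp)+
      then show ?thesis using L by (intro mult_left_mono) auto
    \<comment> \<open>For the empty list natural subtraction makes both indices 0, so the telescoped
      difference vanishes.\<close>
    qed (use L ab in simp)
    finally show "ereal (\<Sum>i<length xs - 1. \<bar>f (xs ! Suc i) - f (xs ! i)\<bar>) \<le> ereal (L * (b - a))"
      by simp
  qed
  finally show ?thesis .
qed

text \<open>At the fixed point the Lasota-Yorke inequality reads
  \<open>v \<le> \<gamma> * v + C * (1 - x0)\<close> for the variation \<open>v\<close>, which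
  bounds \<open>v\<close>. The mean of \<open>f\<close> is 1, so its minimum is at most 1, and
  \<open>f\<close> exceeds its minimum by at most \<open>v\<close>.\<close>

lemma invariant_density_le:
  assumes x0: "x0 < 1"
    and inv: "hat_invariant_density x0 T f" and L: "L-lipschitz_on {x0..1} f"
    and \<gamma>: "\<gamma> < 1"
    and LY: "\<And>f. f \<in> BV_on {x0..1} \<Longrightarrow> variation_on {x0..1} (hat_L x0 T f)
             \<le> ereal \<gamma> * variation_on {x0..1} f + ereal (C * L1_norm_on {x0..1} f)"
    and x: "x \<in> {x0..1}"
  shows "f x \<le> 1 + C * (1 - x0) / (1 - \<gamma>)"
proof -
  have f: "continuous_on {x0..1} f" "\<forall>x\<in>{x0..1}. 0 \<le> f x" "(LINT x|hat_lambda x0. f x) = 1"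
    and ae: "AE x in lebesgue_on {x0..1}. hat_L x0 T f x = f x"
    using inv lipschitz_on_continuous_on[OF L] AE_hat_lambda[OF x0]
    by (auto simp: hat_invariant_density_def)
  have "compact {x0..1}" "{x0..1} \<noteq> {}" using x0 by auto
  then obtain y where y: "y \<in> {x0..1}" "\<And>z. z \<in> {x0..1} \<Longrightarrow> f y \<le> f z"
    using continuous_attains_inf[OF _ _ f(1)] by blast
  have "(LINT z|hat_lambda x0. f y) \<le> (LINT z|hat_lambda x0. f z)"
    using y(2) by (intro integral_mono integrable_hat_lambda x0 f)
      (auto simp: space_hat_lambda[OF x0])
  then have fy: "f y \<le> 1"
    using f(3) by (simp add: space_hat_lambda[OF x0] measure_hat_lambda_Delta[OF x0])
  \<comment> \<open>The Lipschitz bound from above and \<open>ge\<close> from below make the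
    variation a real number; only then can \<open>\<gamma> * v\<close> be subtracted.\<close>
  have "variation_on {x0..1} f \<le> ereal (L * (1 - x0))"
    using x0 by (intro variation_on_le_Lipschitz[OF L]) simp
  moreover have ge: "ereal (f x - f y) \<le> variation_on {x0..1} f"
    unfolding variation_on_def using diff_le_pointwise_variation[OF f(1) x0 _ x y(1)]
    by (intro INF_greatest) auto
  ultimately obtain v where v: "variation_on {x0..1} f = ereal v"
    by (cases "variation_on {x0..1} f") auto
  \<comment> \<open>The fixed point equation holds only almost everywhere, which suffices because
    \<open>variation_on\<close> ranges over all representatives.\<close>
  have "variation_on {x0..1} (hat_L x0 T f) = variation_on {x0..1} f"
  proof -
    have "(AE x in lebesgue_on {x0..1}. g x = hat_L x0 T f x) \<longleftrightarrow>
        (AE x in lebesgue_on {x0..1}. g x = f x)" for g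
      using ae by (intro eventually_subst) (auto elim: eventually_mono)
    then show ?thesis by (simp add: variation_on_def)
  qed
  moreover have "f \<in> BV_on {x0..1}"
    by (simp add: BV_on_def v)
  ultimately have "v \<le> \<gamma> * v + C * L1_norm_on {x0..1} f"
    using LY[of f] by (simp add: v)
  also have "L1_norm_on {x0..1} f = 1 - x0"
    using L1_norm_on_Delta[OF x0 f(1,2)] f(3) by simp
  finally have "v * (1 - \<gamma>) \<le> C * (1 - x0)"
    by (simp add: algebra_simps)
  then have "v \<le> C * (1 - x0) / (1 - \<gamma>)"
    using \<gamma> by (simp add: pos_le_divide_eq)
  then show ?thesis
    using ge fy by (simp add: v)
qed

text \<open>Images under \<open>P_op\<close> are finite linear combinations of hat functions, and
  the fixed point equation holds at every point of the interval.\<close>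

lemma discrete_density_continuous:
  assumes "discrete_invariant_density x0 T m f"
  shows "continuous_on {x0..1} f"
proof -
  have "continuous_on {x0..1} (P_op x0 T m f)"
    unfolding P_op_def Q_def by (intro continuous_intros hat_fun_continuous)
  then show ?thesis
    by (rule continuous_on_eq) (use assms in \<open>auto simp: discrete_invariant_density_def\<close>)
qed

section \<open>The neutral branch\<close>

context neutral_map
begin

text \<open>At interior points the derivative within \<open>{0..x0}\<close> is two-sided, and
  \<open>T\<close> and \<open>T1\<close> agree nearby; so \<open>deriv T\<close> is a genuine
  derivative of both.\<close>

lemma T1_deriv_left:
  assumes x: "x \<in> {0<..<x0}"
  shows "(T1 has_real_derivative deriv T x) (at x)"
    and "(T has_real_derivative deriv T x) (at x)"
proof -
  obtain f' where "\<forall>x\<in>{0..x0}. (T1 has_real_derivative f' x) (at x within {0..x0})"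
    using T1_C1 unfolding C1_on_def by blast
  then have d: "(T1 has_real_derivative f' x) (at x)"
    using x by (metis at_within_Icc_at atLeastAtMost_iff greaterThanLessThan_iff less_eq_real_def)
  then have "(T has_real_derivative f' x) (at x)"
    by (rule has_field_derivative_transform_within_open[where S = "{0<..<x0}"])
      (use x in \<open>auto simp: T1_eq\<close>)
  moreover from this have "deriv T x = f' x" by (rule DERIV_imp_deriv)
  ultimately show "(T1 has_real_derivative deriv T x) (at x)"
    and "(T has_real_derivative deriv T x) (at x)"
    using d by simp_all
qed

lemma T1_continuous: "continuous_on {0..x0} T1"
  using T1_C1 unfolding C1_on_def
  by (metis DERIV_continuous continuous_on_eq_continuous_within)

lemma delta0_eq:
  assumes "x \<in> {0<..x0}"
  shows "\<delta>0 x = (T1 x - x) / x powr (1 + \<alpha>) - 1"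
  using assms T1_expansion[of x] by (simp add: field_simps)

lemma delta0_continuous: "continuous_on {0<..x0} \<delta>0"
proof -
  have "continuous_on {0<..x0} (\<lambda>x. (T1 x - x) / x powr (1 + \<alpha>) - 1)"
    by (intro continuous_intros continuous_on_subset[OF T1_continuous]) auto
  then show ?thesis
    by (rule continuous_on_eq) (simp add: delta0_eq)
qed

text \<open>The hypothesis on \<open>deriv \<delta>0\<close> speaks of the value of the
  \<open>deriv\<close> operator. Monotonicity needs an actual derivative, which the quotient formula
  \<open>delta0_eq\<close> supplies through \<open>T1\<close>.\<close>

lemma delta0_has_deriv:
  assumes x: "x \<in> {0<..<x0}"
  shows "(\<delta>0 has_real_derivative deriv \<delta>0 x) (at x)"
proof -
  have "((\<lambda>x. x powr (1 + \<alpha>)) has_real_derivative (1 + \<alpha>) * x powr \<alpha>) (at x)"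
    using x by (auto intro!: derivative_eq_intros)
  moreover have "x powr (1 + \<alpha>) \<noteq> 0"
    using x by simp
  ultimately obtain d where
    "((\<lambda>x. (T1 x - x) / x powr (1 + \<alpha>) - 1) has_real_derivative d) (at x)"
    using DERIV_diff[OF DERIV_divide[OF DERIV_diff[OF T1_deriv_left(1)[OF x] DERIV_ident]] DERIV_const]
    by blast
  then have "(\<delta>0 has_real_derivative d) (at x)"
    by (rule has_field_derivative_transform_within_open[where S = "{0<..<x0}"])
      (use x in \<open>auto simp: delta0_eq\<close>)
  then show ?thesis
    using DERIV_imp_deriv by blast
qed

lemma delta0_mono:
  assumes "0 < x" "x \<le> y" "y \<le> x0"
  shows "\<delta>0 x \<le> \<delta>0 y"
proof (rule DERIV_nonneg_imp_increasing_open[where f = \<delta>0])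
  show "continuous_on {x..y} \<delta>0"
    using assms by (intro continuous_on_subset[OF delta0_continuous]) auto
  fix z assume "x < z" "z < y"
  then show "\<exists>d. (\<delta>0 has_real_derivative d) (at z) \<and> 0 \<le> d"
    using assms delta0_has_deriv[of z] delta0_deriv[of z] by auto
qed fact

text \<open>By monotonicity the values to the left of \<open>x\<close> are at most
  \<open>\<delta>0 x\<close>; their limit at 0 is 0.\<close>

lemma delta0_nonneg:
  assumes "0 < x" "x \<le> x0"
  shows "0 \<le> \<delta>0 x"
proof (rule tendsto_upperbound[OF delta0_lim])
  have "\<forall>\<^sub>F y in at_right 0. y \<in> {0<..<x}"
    using assms by (intro eventually_at_right_real)
  then show "\<forall>\<^sub>F y in at_right 0. \<delta>0 y \<le> \<delta>0 x"
    by eventually_elim (use assms delta0_mono in auto)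
qed simp

text \<open>By continuity \<open>T1 x0\<close> is a limit of values of \<open>T\<close> below 1.
  Inserted into the expansion at \<open>x0\<close>, this is the source of the first factor of
  \<open>const_C2\<close>.\<close>

lemma delta0_x0: "1 + \<delta>0 x0 \<le> (1 - x0) / x0 powr (1 + \<alpha>)"
proof -
  have "T1 x0 \<le> 1"
  proof (rule continuous_le_on_closure[where f = T1 and S = "{0..<x0}"])
    show "continuous_on (closure {0..<x0}) T1" "x0 \<in> closure {0..<x0}"
      using T1_continuous x0 by auto
    show "T1 x \<le> 1" if "x \<in> {0..<x0}" for x
    proof -
      have "T x \<in> {0..<1}"
        using that T_onto_left by blast
      then show ?thesis
        using T1_eq[OF that] by simp
    qed
  qed
  then show ?thesis
    using T1_expansion[of x0] x0 by (simp add: field_simps)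
qed

lemma T_left:
  assumes "x \<in> {0<..<x0}"
  shows "T x = x + x powr (1 + \<alpha>) * (1 + \<delta>0 x)"
  using assms T1_expansion[of x] T1_eq[of x] by (simp add: algebra_simps)

lemma T_left':
  assumes "x \<in> {0<..<x0}"
  shows "T x = x * (1 + x powr \<alpha> * (1 + \<delta>0 x))"
  using assms by (simp add: T_left powr_add algebra_simps)

lemma T_left_ge:
  assumes x: "x \<in> {0<..<x0}"
  shows "x * (1 + x powr \<alpha>) \<le> T x"
proof -
  have "x powr \<alpha> * 1 \<le> x powr \<alpha> * (1 + \<delta>0 x)"
    using x delta0_nonneg[of x] by (intro mult_left_mono) auto
  then show ?thesis
    using x by (simp add: T_left')
qed

lemma T_left_gt:
  assumes x: "x \<in> {0<..<x0}"
  shows "x < T x"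
proof -
  have "x * 1 < x * (1 + x powr \<alpha>)"
    using x by (intro mult_strict_left_mono) auto
  then show ?thesis
    using T_left_ge[OF x] by simp
qed

text \<open>Differentiating the expansion gives the left side plus
  \<open>x powr (1 + \<alpha>) * deriv \<delta>0 x\<close>, which is nonnegative.\<close>

lemma deriv_T_left_ge:
  assumes x: "x \<in> {0<..<x0}"
  shows "1 + (1 + \<alpha>) * (x powr \<alpha> * (1 + \<delta>0 x)) \<le> deriv T x"
proof -
  have "((\<lambda>x. x + x powr (1 + \<alpha>) * (1 + \<delta>0 x)) has_real_derivative
     1 + ((1 + \<alpha>) * x powr \<alpha> * (1 + \<delta>0 x) + x powr (1 + \<alpha>) * deriv \<delta>0 x)) (at x)"
    using x delta0_has_deriv[OF x] by (auto intro!: derivative_eq_intros)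
  then have "(T has_real_derivative
     1 + ((1 + \<alpha>) * x powr \<alpha> * (1 + \<delta>0 x) + x powr (1 + \<alpha>) * deriv \<delta>0 x)) (at x)"
    by (rule has_field_derivative_transform_within_open[where S = "{0<..<x0}"])
      (use x in \<open>auto simp: T_left\<close>)
  then have "deriv T x = 1 + ((1 + \<alpha>) * x powr \<alpha> * (1 + \<delta>0 x) + x powr (1 + \<alpha>) * deriv \<delta>0 x)"
    by (rule DERIV_imp_deriv)
  moreover have "0 \<le> x powr (1 + \<alpha>) * deriv \<delta>0 x"
    using delta0_deriv[OF x] by simp
  ultimately show ?thesis by (simp add: algebra_simps)
qed

text \<open>Telescopes along backward orbits, where \<open>x powr (2 * \<alpha>)\<close> is summable.\<close>

lemma T_ratio_le:
  assumes x: "x \<in> {0<..<x0}"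
  shows "(T x / x) powr (1 + \<alpha>) \<le> deriv T x * exp (const_C0 \<alpha> (\<delta>0 x0) * x powr (2 * \<alpha>))"
proof -
  define u where "u = x powr \<alpha> * (1 + \<delta>0 x)"
  have d: "0 \<le> \<delta>0 x" "\<delta>0 x \<le> \<delta>0 x0"
    using x delta0_nonneg[of x] delta0_mono[of x x0] by auto
  have u: "0 \<le> u" using d by (simp add: u_def)
  have "(T x / x) powr (1 + \<alpha>) = (1 + u) powr (1 + \<alpha>)"
    using x by (simp add: T_left' u_def)
  also have "\<dots> \<le> 1 + (1 + \<alpha>) * u + \<alpha> * (1 + \<alpha>) / 2 * u\<^sup>2"
    using alpha u by (intro powr_one_plus_Taylor) auto
  also have "\<alpha> * (1 + \<alpha>) / 2 * u\<^sup>2 \<le> const_C0 \<alpha> (\<delta>0 x0) * x powr (2 * \<alpha>)"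
  proof -
    have "u\<^sup>2 = x powr (2 * \<alpha>) * (1 + \<delta>0 x)\<^sup>2"
      using x by (simp add: u_def power_mult_distrib powr_power)
    also have "\<dots> \<le> x powr (2 * \<alpha>) * (1 + \<delta>0 x0)\<^sup>2"
      using d by (intro mult_left_mono power_mono) auto
    also have "(1 + \<delta>0 x0)\<^sup>2 = 1 + 2 * \<delta>0 x0 + (\<delta>0 x0)\<^sup>2"
      by (simp add: power2_sum)
    finally have "\<alpha> * (1 + \<alpha>) / 2 * u\<^sup>2
        \<le> \<alpha> * (1 + \<alpha>) / 2 * (x powr (2 * \<alpha>) * (1 + 2 * \<delta>0 x0 + (\<delta>0 x0)\<^sup>2))"
      using alpha by (intro mult_left_mono) auto
    then show ?thesis by (simp add: const_C0_def mult_ac)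
  qed
  \<comment> \<open>Since \<open>deriv T x > 1\<close>, the second-order term may be multiplied by
    it, which turns the sum into a product.\<close>
  also have "1 + (1 + \<alpha>) * u + const_C0 \<alpha> (\<delta>0 x0) * x powr (2 * \<alpha>)
      \<le> deriv T x * (1 + const_C0 \<alpha> (\<delta>0 x0) * x powr (2 * \<alpha>))"
  proof -
    have "0 \<le> const_C0 \<alpha> (\<delta>0 x0) * x powr (2 * \<alpha>)"
      using alpha d by (simp add: const_C0_def)
    then have "const_C0 \<alpha> (\<delta>0 x0) * x powr (2 * \<alpha>)
       \<le> deriv T x * (const_C0 \<alpha> (\<delta>0 x0) * x powr (2 * \<alpha>))"
      using T_deriv_left[OF x] by (simp add: mult_le_cancel_right1)
    then show ?thesis
      using deriv_T_left_ge[OF x] by (simp add: u_def distrib_left)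
  qed
  also have "\<dots> \<le> deriv T x * exp (const_C0 \<alpha> (\<delta>0 x0) * x powr (2 * \<alpha>))"
    using T_deriv_left[OF x] by (intro mult_left_mono exp_ge_add_one_self) auto
  finally show ?thesis by simp
qed

section \<open>Backward orbits along the neutral branch\<close>

lemma T1_inv_in:
  assumes "x \<in> {0<..<1}"
  shows "T1_inv x0 T x \<in> {0<..<x0}" and "T (T1_inv x0 T x) = x"
proof -
  have x: "x \<in> T ` {0..<x0}"
    using assms by (simp add: T_onto_left)
  from f_inv_into_f[OF this] show T: "T (T1_inv x0 T x) = x"
    by (simp add: T1_inv_def)
  have "T1_inv x0 T x \<in> {0..<x0}"
    unfolding T1_inv_def by (rule inv_into_into[OF x])
  moreover have "T1_inv x0 T x \<noteq> 0"
    using T T_0 assms by auto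
  ultimately show "T1_inv x0 T x \<in> {0<..<x0}" by auto
qed

lemma T1_inv_funpow_in:
  assumes "x \<in> {0<..<1}"
  shows "(T1_inv x0 T ^^ k) x \<in> {0<..<1}"
  using assms by (induction k) (use T1_inv_in(1) x0 in force)+

lemma T1_inv_funpow_Suc:
  assumes "x \<in> {0<..<1}"
  shows "(T1_inv x0 T ^^ Suc k) x \<in> {0<..<x0}"
    and "T ((T1_inv x0 T ^^ Suc k) x) = (T1_inv x0 T ^^ k) x"
  using T1_inv_in[OF T1_inv_funpow_in[OF assms, of k]] by simp_all

text \<open>Both facts feed the decay estimate for backward orbits: the first closes its induction
  step, the second starts it. They rest on \<open>1 / \<alpha>\<close> exceeding 1.\<close>

lemma const_C1_powr: "const_C1 \<alpha> powr \<alpha> = 2 * (2 powr (1 / \<alpha>) - 1)"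
  and const_C1_ge_1: "1 \<le> const_C1 \<alpha>"
proof -
  have "(2::real) powr 1 \<le> 2 powr (1 / \<alpha>)"
    using alpha by (intro powr_mono) auto
  then have p: "1 \<le> (2::real) powr (1 / \<alpha>) - 1" by simp
  then show "const_C1 \<alpha> powr \<alpha> = 2 * (2 powr (1 / \<alpha>) - 1)"
    using alpha by (simp add: const_C1_def powr_powr)
  show "1 \<le> const_C1 \<alpha>"
    using p alpha unfolding const_C1_def by (intro ge_one_powr_ge_zero) auto
qed

text \<open>Induction on \<open>n\<close>. The function \<open>t * (1 + t powr \<alpha>)\<close> is
  increasing and lies below \<open>T\<close>, so a point above the bound for \<open>n + 1\<close>
  would be mapped above the bound for \<open>n\<close>.\<close>

lemma T1_inv_funpow_le:
  assumes x: "x \<in> {0<..<1}" and n: "1 \<le> n"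
  shows "(T1_inv x0 T ^^ n) x \<le> const_C1 \<alpha> * real n powr - (1 / \<alpha>)"
  using n
proof (induction n rule: dec_induct)
  case base
  then show ?case
    using const_C1_ge_1 T1_inv_funpow_in[OF x, of 1] by simp
next
  case (step n)
  define z where "z = (T1_inv x0 T ^^ Suc n) x"
  define C where "C = const_C1 \<alpha>"
  define p where "p = 1 / \<alpha>"
  define b where "b = C * real (Suc n) powr - p"
  have z: "z \<in> {0<..<x0}" "T z = (T1_inv x0 T ^^ n) x"
    using T1_inv_funpow_Suc[OF x] by (simp_all add: z_def)
  have n: "0 < real n" and C: "0 < C" and p: "1 \<le> p" "p * \<alpha> = 1"
    using step const_C1_ge_1 alpha by (auto simp: C_def p_def)
  have b: "0 < b" using C by (simp add: b_def)
  have "z \<le> b"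
  proof (rule ccontr)
    assume "\<not> z \<le> b"
    then have bz: "b < z" by simp
    have "(2 powr p - 1) / real n \<le> b powr \<alpha>"
    proof -
      have "b powr \<alpha> = 2 * (2 powr p - 1) / real (Suc n)"
        using alpha const_C1_powr by (simp add: b_def powr_divide powr_powr C_def p_def powr_minus_divide)
      \<comment> \<open>The factor 2 in \<open>const_C1\<close> pays for the index shift from
        \<open>n\<close> to \<open>n + 1\<close>.\<close>
      moreover have "1 / real n \<le> 2 / real (Suc n)"
        using step(1) by (simp add: field_simps)
      then have "(2 powr p - 1) * (1 / real n) \<le> (2 powr p - 1) * (2 / real (Suc n))"
        using p by (intro mult_left_mono) (auto intro: ge_one_powr_ge_zero)
      ultimately show ?thesis by (simp add: mult.commute)
    qed
    then have "(1 + 1 / real n) powr p \<le> 1 + b powr \<alpha>"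
      using powr_one_plus_inverse_le[OF p(1) step(1)] by linarith
    then have "b * (1 + 1 / real n) powr p \<le> b * (1 + b powr \<alpha>)"
      using b by simp
    also have "\<dots> < z * (1 + z powr \<alpha>)"
      using b bz alpha by (intro mult_strict_mono add_strict_left_mono powr_less_mono2)
        (auto intro: add_pos_nonneg)
    also have "\<dots> \<le> T z"
      by (rule T_left_ge[OF z(1)])
    also have "T z \<le> C * real n powr - p"
      using step.IH by (simp add: z C_def p_def)
    finally have lt: "b * (1 + 1 / real n) powr p < C * real n powr - p" .
    \<comment> \<open>The factor \<open>(1 + 1 / real n) powr p\<close> turns the bound for
      \<open>n + 1\<close> into exactly the bound for \<open>n\<close>, contradicting the strict
      inequality \<open>lt\<close>.\<close>
    have "1 + 1 / real n = real (Suc n) / real n"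
      using n by (simp add: field_simps)
    then have "b * (1 + 1 / real n) powr p = C * real n powr - p"
      using n by (simp add: b_def powr_divide powr_minus field_simps)
    with lt show False by simp
  qed
  then show ?case by (simp add: z_def b_def C_def p_def)
qed

section \<open>The expanding branch\<close>

lemma T_right_deriv:
  assumes y: "y \<in> {x0<..<1}"
  shows "(T has_real_derivative deriv T y) (at y)"
proof -
  obtain f' where "\<forall>x\<in>{x0..1}. (T has_real_derivative f' x) (at x within {x0..1})"
    using T2_C2 unfolding C2_on_def by blast
  then have "(T has_real_derivative f' y) (at y)"
    using y by (metis at_within_Icc_at atLeastAtMost_iff greaterThanLessThan_iff less_eq_real_def)
  then show ?thesis
    by (simp add: DERIV_imp_deriv)
qed

lemma T_right_continuous: "continuous_on {x0..1} T"
  using T2_C2 unfolding C2_on_def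
  by (metis DERIV_continuous continuous_on_eq_continuous_within)

text \<open>Mean value theorem; the absolute values cover increasing and decreasing branches
  alike.\<close>

lemma T_right_expanding:
  assumes "y \<in> {x0..1}" "y' \<in> {x0..1}"
  shows "\<beta> * \<bar>y - y'\<bar> \<le> \<bar>T y - T y'\<bar>"
proof -
  have less: "\<beta> * (b - a) \<le> \<bar>T b - T a\<bar>" if ab: "x0 \<le> a" "a < b" "b \<le> 1" for a b
  proof -
    have "continuous_on {a..b} T"
      using ab by (intro continuous_on_subset[OF T_right_continuous]) auto
    moreover have "T differentiable (at x)" if "a < x" "x < b" for x
      using T_right_deriv[of x] that ab by (auto simp: real_differentiable_def)
    ultimately obtain l z where z: "a < z" "z < b" "(T has_real_derivative l) (at z)"
      and eq: "T b - T a = (b - a) * l"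
      using MVT[OF ab(2)] by metis
    have "deriv T z = l"
      using z(3) by (rule DERIV_imp_deriv)
    then have "\<beta> \<le> \<bar>l\<bar>"
      using T_deriv_right[of z] z ab by auto
    then have "(b - a) * \<beta> \<le> (b - a) * \<bar>l\<bar>"
      using ab by (intro mult_left_mono) auto
    then show ?thesis
      using ab by (simp add: eq abs_mult mult.commute)
  qed
  show ?thesis
    using less[of y y'] less[of y' y] assms
    by (cases y y' rule: linorder_cases) (auto simp: abs_minus_commute)
qed

lemma T_right_inj: "inj_on T {x0..1}"
  using T_right_expanding beta by (fastforce intro!: inj_onI simp: mult_le_0_iff)

lemma T_right_in: "y \<in> {x0..1} \<Longrightarrow> T y \<in> {0..1}"
  using T_onto_right by blast

text \<open>A continuous injective function on an interval is strictly monotone, so an interior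
  value lies strictly between the end values, which belong to \<open>{0..1}\<close>.\<close>

lemma T_right_interior:
  assumes y: "y \<in> {x0<..<1}"
  shows "T y \<in> {0<..<1}"
  using continuous_inj_imp_mono[OF _ _ T_right_continuous T_right_inj, of y] y
    T_right_in[of x0] T_right_in[of 1] x0
  by auto

text \<open>An interior point is mapped into the open unit interval, so the end points of the image
  must be attained at the end points.\<close>

lemma T_right_ends: "T ` {x0, 1} = {0, 1}"
proof -
  have "{0, 1} \<subseteq> T ` {x0, 1}"
  proof
    fix v :: real assume v: "v \<in> {0, 1}"
    then have "v \<in> T ` {x0..1}"
      by (auto simp: T_onto_right)
    then obtain y where y: "y \<in> {x0..1}" "v = T y" by blast
    then have "y \<notin> {x0<..<1}"
      using T_right_interior v by fastforce
    then show "v \<in> T ` {x0, 1}"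
      using y by force
  qed
  moreover have "card (T ` {x0, 1}) \<le> card {x0, 1}"
    by (rule card_image_le) simp
  then have "card (T ` {x0, 1}) \<le> card {0, 1::real}"
    using x0 by simp
  ultimately show ?thesis
    by (metis card_seteq finite.emptyI finite_imageI finite_insert)
qed

text \<open>The end points are mapped to 0 and 1, so the preimage is an interior point, where
  \<open>deriv T\<close> is a two-sided derivative.\<close>

lemma T2_inv_in:
  assumes "z \<in> {0<..<1}"
  shows "T2_inv x0 T z \<in> {x0<..<1}" and "T (T2_inv x0 T z) = z"
proof -
  have z: "z \<in> T ` {x0..1}"
    using assms by (simp add: T_onto_right)
  from f_inv_into_f[OF this] show T: "T (T2_inv x0 T z) = z"
    by (simp add: T2_inv_def)
  have "T2_inv x0 T z \<in> {x0..1}"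
    unfolding T2_inv_def by (rule inv_into_into[OF z])
  moreover have "T2_inv x0 T z \<notin> {x0, 1}"
  proof
    assume "T2_inv x0 T z \<in> {x0, 1}"
    then have "T (T2_inv x0 T z) \<in> {0, 1}"
      unfolding T_right_ends[symmetric] by (rule imageI)
    then show False
      using assms by (simp add: T)
  qed
  ultimately show "T2_inv x0 T z \<in> {x0<..<1}" by auto
qed

section \<open>Derivatives of iterates and the weights of the density series\<close>

text \<open>The quotient \<open>x / z k\<close> is the product of the ratios
  \<open>T (z j) / z j\<close>, and by the chain rule \<open>D\<close> is the product of the
  \<open>deriv T (z j)\<close>; \<open>T_ratio_le\<close> compares the factors.\<close>

lemma T_funpow_deriv:
  assumes x: "x \<in> {0<..<x0}"
  defines "z \<equiv> \<lambda>k. (T1_inv x0 T ^^ k) x"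
  shows "\<exists>D>0. ((T ^^ k) has_real_derivative D) (at (z k)) \<and>
    (x / z k) powr (1 + \<alpha>) \<le> D * exp (const_C0 \<alpha> (\<delta>0 x0) * (\<Sum>j=1..k. z j powr (2 * \<alpha>)))"
proof (induction k)
  case 0
  have "((T ^^ 0) has_real_derivative 1) (at (z 0))"
    unfolding funpow_0 by (simp add: id_def)
  then show ?case
    using x by (intro exI[of _ 1]) (simp add: z_def)
next
  case (Suc k)
  have x1: "x \<in> {0<..<1}" using x x0 by auto
  have zk: "0 < z k" using T1_inv_funpow_in[OF x1, of k] by (simp add: z_def)
  have z: "z (Suc k) \<in> {0<..<x0}" "T (z (Suc k)) = z k"
    using T1_inv_funpow_Suc[OF x1, of k] by (simp_all add: z_def)
  obtain D where D: "D > 0" "((T ^^ k) has_real_derivative D) (at (z k))"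
    "(x / z k) powr (1 + \<alpha>) \<le> D * exp (const_C0 \<alpha> (\<delta>0 x0) * (\<Sum>j=1..k. z j powr (2 * \<alpha>)))"
    using Suc by blast
  define d where "d = deriv T (z (Suc k))"
  have d: "d > 0" using T_deriv_left[OF z(1)] by (simp add: d_def)
  have "((T ^^ k) has_real_derivative D) (at (T (z (Suc k))))"
    using D(2) by (simp add: z(2))
  from DERIV_chain[OF this T1_deriv_left(2)[OF z(1)]]
  have "((T ^^ Suc k) has_real_derivative D * d) (at (z (Suc k)))"
    by (simp only: funpow_Suc_right d_def)
  moreover have "(x / z (Suc k)) powr (1 + \<alpha>)
      \<le> D * d * exp (const_C0 \<alpha> (\<delta>0 x0) * (\<Sum>j=1..Suc k. z j powr (2 * \<alpha>)))"
  proof -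
    have "x / z (Suc k) = (x / z k) * (z k / z (Suc k))"
      using zk by simp
    then have "(x / z (Suc k)) powr (1 + \<alpha>)
      = (x / z k) powr (1 + \<alpha>) * (T (z (Suc k)) / z (Suc k)) powr (1 + \<alpha>)"
    by (simp only: powr_mult z(2))
  also have "\<dots> \<le> (D * exp (const_C0 \<alpha> (\<delta>0 x0) * (\<Sum>j=1..k. z j powr (2 * \<alpha>))))
      * (d * exp (const_C0 \<alpha> (\<delta>0 x0) * z (Suc k) powr (2 * \<alpha>)))"
    unfolding d_def using D T_ratio_le[OF z(1)] by (intro mult_mono) auto
  also have "\<dots> = D * d * exp (const_C0 \<alpha> (\<delta>0 x0) * (\<Sum>j=1..Suc k. z j powr (2 * \<alpha>)))"
    by (simp add: distrib_left exp_add)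
  finally show ?thesis .
  qed
  ultimately show ?case
    using D(1) d by (intro exI[of _ "D * d"] conjI mult_pos_pos)
qed

text \<open>The coefficient of the density in the \<open>n\<close>-th term of
  \<open>full_density\<close>. It does not depend on the density, so two densities can be compared
  term by term.\<close>

definition branch_weight :: "real \<Rightarrow> nat \<Rightarrow> real" where
  "branch_weight x n = 1 / \<bar>deriv (T ^^ n) (T2_inv x0 T ((T1_inv x0 T ^^ (n - 1)) x))\<bar>"

lemma branch_weight_nonneg: "0 \<le> branch_weight x n"
  by (simp add: branch_weight_def)

text \<open>The decay exponent \<open>1 / \<alpha>\<close> becomes 2 after raising to
  \<open>2 * \<alpha>\<close>, and \<open>sum_powr_le\<close> bounds the sum of inverse squares by
  2.\<close>

lemma sum_T1_inv_funpow_le: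
  assumes x: "x \<in> {0<..<1}"
  shows "(\<Sum>j=1..k. (T1_inv x0 T ^^ j) x powr (2 * \<alpha>)) \<le> 2 * const_C1 \<alpha> powr (2 * \<alpha>)"
proof -
  have "(\<Sum>j=1..k. (T1_inv x0 T ^^ j) x powr (2 * \<alpha>))
      \<le> (\<Sum>j=1..k. const_C1 \<alpha> powr (2 * \<alpha>) * real j powr - 2)"
  proof (rule sum_mono)
    fix j assume "j \<in> {1..k}"
    then have "(T1_inv x0 T ^^ j) x powr (2 * \<alpha>) \<le> (const_C1 \<alpha> * real j powr - (1 / \<alpha>)) powr (2 * \<alpha>)"
      using T1_inv_funpow_le[OF x, of j] T1_inv_funpow_in[OF x, of j] alpha
      by (intro powr_mono2) auto
    also have "\<dots> = const_C1 \<alpha> powr (2 * \<alpha>) * real j powr (- (1 / \<alpha>) * (2 * \<alpha>))"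
      by (simp only: powr_mult powr_powr)
    also have "- (1 / \<alpha>) * (2 * \<alpha>) = - 2"
      using alpha by simp
    finally show "(T1_inv x0 T ^^ j) x powr (2 * \<alpha>) \<le> const_C1 \<alpha> powr (2 * \<alpha>) * real j powr - 2" .
  qed
  also have "\<dots> = const_C1 \<alpha> powr (2 * \<alpha>) * (\<Sum>j=1..k. real j powr - 2)"
    by (simp only: sum_distrib_left)
  also have "\<dots> \<le> const_C1 \<alpha> powr (2 * \<alpha>) * 2"
    using sum_powr_le[of 2 k] by (intro mult_left_mono) auto
  finally show ?thesis by simp
qed

text \<open>\<open>T ^^ n\<close> is one step on the expanding branch, contributing a factor of at
  least \<beta>, followed by \<open>n - 1\<close> steps on the neutral branch, controlled by
  \<open>T_funpow_deriv\<close>.\<close>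

lemma branch_weight_le:
  assumes x: "x \<in> {0<..<x0}" and n: "1 \<le> n"
  defines "z \<equiv> (T1_inv x0 T ^^ (n - 1)) x"
  shows "x powr (1 + \<alpha>) * branch_weight x n \<le>
    z powr (1 + \<alpha>) * exp (const_C0 \<alpha> (\<delta>0 x0) *
      (\<Sum>j=1..n - 1. (T1_inv x0 T ^^ j) x powr (2 * \<alpha>))) / \<beta>"
proof -
  have "x \<in> {0<..<1}" using x x0 by auto
  then have z: "z \<in> {0<..<1}"
    using T1_inv_funpow_in[of x "n - 1"] by (simp add: z_def)
  define y where "y = T2_inv x0 T z"
  have y: "y \<in> {x0<..<1}" "T y = z"
    using T2_inv_in[OF z] by (simp_all add: y_def)
  define E where "E = exp (const_C0 \<alpha> (\<delta>0 x0) * (\<Sum>j=1..n - 1. (T1_inv x0 T ^^ j) x powr (2 * \<alpha>)))"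
  obtain D where D: "D > 0" "((T ^^ (n - 1)) has_real_derivative D) (at (T y))"
    "(x / z) powr (1 + \<alpha>) \<le> D * E"
    using T_funpow_deriv[OF x, of "n - 1"] y by (auto simp: z_def E_def)
  have "((T ^^ (n - 1)) \<circ> T has_real_derivative D * deriv T y) (at y)"
    by (rule DERIV_chain[OF D(2) T_right_deriv[OF y(1)]])
  also have "(T ^^ (n - 1)) \<circ> T = T ^^ n"
    using n by (metis One_nat_def Suc_diff_1 Suc_le_lessD funpow_Suc_right)
  finally have "deriv (T ^^ n) y = D * deriv T y"
    by (rule DERIV_imp_deriv)
  then have w: "branch_weight x n = 1 / (D * \<bar>deriv T y\<bar>)"
    using D(1) by (simp add: branch_weight_def y_def z_def abs_mult)
  have "D * \<beta> \<le> D * \<bar>deriv T y\<bar>"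
    using D(1) T_deriv_right[OF y(1)] by simp
  then have "branch_weight x n \<le> 1 / (D * \<beta>)"
    unfolding w using D(1) beta by (intro divide_left_mono) auto
  then have "x powr (1 + \<alpha>) * branch_weight x n \<le> x powr (1 + \<alpha>) * (1 / (D * \<beta>))"
    by (rule mult_left_mono) simp
  \<comment> \<open>After this splitting the bound on \<open>(x / z) powr (1 + \<alpha>)\<close>
    brings in a factor \<open>D\<close> that cancels the one in the denominator.\<close>
  also have "x powr (1 + \<alpha>) * (1 / (D * \<beta>)) = z powr (1 + \<alpha>) * (x / z) powr (1 + \<alpha>) * (1 / (D * \<beta>))"
    using z by (simp flip: powr_mult)
  also have "z powr (1 + \<alpha>) * (x / z) powr (1 + \<alpha>) * (1 / (D * \<beta>))
      \<le> z powr (1 + \<alpha>) * (D * E) * (1 / (D * \<beta>))"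
    using D beta by (intro mult_right_mono mult_left_mono) auto
  also have "\<dots> = z powr (1 + \<alpha>) * E / \<beta>"
    using D(1) by simp
  finally show ?thesis by (simp add: E_def)
qed

lemma branch_weight_1_le:
  assumes x: "x \<in> {0<..<x0}"
  shows "x powr (1 + \<alpha>) * branch_weight x 1 \<le> x0 powr (1 + \<alpha>) / \<beta>"
proof -
  have "x powr (1 + \<alpha>) * branch_weight x 1 \<le> x powr (1 + \<alpha>) / \<beta>"
    using branch_weight_le[OF x, of 1] by simp
  also have "\<dots> \<le> x0 powr (1 + \<alpha>) / \<beta>"
    using x alpha beta by (intro divide_right_mono powr_mono2) auto
  finally show ?thesis .
qed

text \<open>Term \<open>Suc k\<close> involves \<open>k\<close> pullbacks, so their decay enters
  with exponent \<open>(1 + \<alpha>) / \<alpha>\<close>, which exceeds 1; the bound is uniform in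
  \<open>x\<close>.\<close>

lemma branch_weight_Suc_le:
  assumes x: "x \<in> {0<..<x0}" and k: "1 \<le> k"
  shows "x powr (1 + \<alpha>) * branch_weight x (Suc k)
    \<le> const_M \<alpha> \<beta> (\<delta>0 x0) * real k powr - (1 + 1 / \<alpha>)"
proof -
  have x1: "x \<in> {0<..<1}" using x x0 by auto
  define z where "z = (T1_inv x0 T ^^ k) x"
  have z: "0 < z" "z \<le> const_C1 \<alpha> * real k powr - (1 / \<alpha>)"
    using T1_inv_funpow_in[OF x1, of k] T1_inv_funpow_le[OF x1 k] by (simp_all add: z_def)
  have C0: "0 \<le> const_C0 \<alpha> (\<delta>0 x0)"
    using alpha delta0_nonneg[of x0] x0 by (simp add: const_C0_def)
  have "z powr (1 + \<alpha>) \<le> (const_C1 \<alpha> * real k powr - (1 / \<alpha>)) powr (1 + \<alpha>)"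
    using z alpha by (intro powr_mono2) auto
  also have "\<dots> = const_C1 \<alpha> powr (1 + \<alpha>) * real k powr (- (1 / \<alpha>) * (1 + \<alpha>))"
    by (simp only: powr_mult powr_powr)
  also have "- (1 / \<alpha>) * (1 + \<alpha>) = - (1 + 1 / \<alpha>)"
    using alpha by (simp add: field_simps)
  finally have zp: "z powr (1 + \<alpha>) \<le> const_C1 \<alpha> powr (1 + \<alpha>) * real k powr - (1 + 1 / \<alpha>)" .
  have "const_C0 \<alpha> (\<delta>0 x0) * (\<Sum>j=1..k. (T1_inv x0 T ^^ j) x powr (2 * \<alpha>))
      \<le> const_C0 \<alpha> (\<delta>0 x0) * (2 * const_C1 \<alpha> powr (2 * \<alpha>))"
    using sum_T1_inv_funpow_le[OF x1] C0 by (intro mult_left_mono)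
  then have E: "exp (const_C0 \<alpha> (\<delta>0 x0) * (\<Sum>j=1..k. (T1_inv x0 T ^^ j) x powr (2 * \<alpha>)))
      \<le> exp (2 * const_C0 \<alpha> (\<delta>0 x0) * const_C1 \<alpha> powr (2 * \<alpha>))"
    by (simp add: mult_ac)
  have "x powr (1 + \<alpha>) * branch_weight x (Suc k) \<le>
    z powr (1 + \<alpha>) * exp (const_C0 \<alpha> (\<delta>0 x0) *
      (\<Sum>j=1..k. (T1_inv x0 T ^^ j) x powr (2 * \<alpha>))) / \<beta>"
    using branch_weight_le[OF x, of "Suc k"] by (simp add: z_def)
  also have "\<dots> \<le> const_C1 \<alpha> powr (1 + \<alpha>) * real k powr - (1 + 1 / \<alpha>) *
      exp (2 * const_C0 \<alpha> (\<delta>0 x0) * const_C1 \<alpha> powr (2 * \<alpha>)) / \<beta>"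
    using zp E beta by (intro divide_right_mono mult_mono) auto
  finally show ?thesis by (simp add: const_M_def mult_ac)
qed

lemma const_M_nonneg: "0 \<le> const_M \<alpha> \<beta> d"
  using beta by (simp add: const_M_def)

lemma branch_weight_infsum:
  assumes x: "x \<in> {0<..<x0}"
  shows "(\<lambda>n. x powr (1 + \<alpha>) * branch_weight x n) summable_on {1..}" (is "?g summable_on _")
    and "(\<Sum>\<^sub>\<infinity>n\<in>{1..}. x powr (1 + \<alpha>) * branch_weight x n)
       \<le> x0 powr (1 + \<alpha>) / \<beta> + const_M \<alpha> \<beta> (\<delta>0 x0) * (1 + \<alpha>)" (is "_ \<le> ?B")
proof -
  have le: "(\<Sum>n=1..N. ?g n) \<le> ?B" for N
  proof (cases N)
    case 0
    then show ?thesis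
      using const_M_nonneg alpha beta by (auto intro!: add_nonneg_nonneg)
  next
    case (Suc N')
    have "(\<Sum>n=1..N. ?g n) = ?g 1 + (\<Sum>k=1..N'. ?g (Suc k))"
      unfolding Suc by (subst sum.atLeast_Suc_atMost) (simp_all add: sum.shift_bounds_cl_Suc_ivl del: sum.cl_ivl_Suc)
    also have "\<dots> \<le> x0 powr (1 + \<alpha>) / \<beta>
        + (\<Sum>k=1..N'. const_M \<alpha> \<beta> (\<delta>0 x0) * real k powr - (1 + 1 / \<alpha>))"
      using branch_weight_1_le[OF x] branch_weight_Suc_le[OF x] by (intro add_mono sum_mono) auto
    also have "(\<Sum>k=1..N'. const_M \<alpha> \<beta> (\<delta>0 x0) * real k powr - (1 + 1 / \<alpha>))
        = const_M \<alpha> \<beta> (\<delta>0 x0) * (\<Sum>k=1..N'. real k powr - (1 + 1 / \<alpha>))"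
      by (simp only: sum_distrib_left)
    \<comment> \<open>For \<open>s = 1 + 1 / \<alpha>\<close> the bound
      \<open>1 + 1 / (s - 1)\<close> equals \<open>1 + \<alpha>\<close>.\<close>
    also have "\<dots> \<le> const_M \<alpha> \<beta> (\<delta>0 x0) * (1 + \<alpha>)"
      using sum_powr_le[of "1 + 1 / \<alpha>" N'] alpha const_M_nonneg by (intro mult_left_mono) auto
    finally show ?thesis by simp
  qed
  have nonneg: "0 \<le> ?g n" for n by (simp add: branch_weight_nonneg)
  from nonneg_infsum_atLeast_1[OF nonneg le]
  show "?g summable_on {1..}" "infsum ?g {1..} \<le> ?B" by blast+
qed

lemma full_density_left:
  assumes "x < x0"
  shows "full_density x0 T f x = c_tau x0 T f *
    (\<Sum>\<^sub>\<infinity>n\<in>{1..}. f (T2_inv x0 T ((T1_inv x0 T ^^ (n - 1)) x)) * branch_weight x n)"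
  using assms by (simp add: full_density_def branch_weight_def)

text \<open>Moving the normalizing constants into the series makes the termwise difference at most
  \<open>D\<close> times a weight. The bound \<open>B\<close> gives summability of each series, so
  that they may be subtracted.\<close>

lemma full_density_diff_left:
  assumes x: "x \<in> {0<..<x0}"
    and f: "\<And>y. y \<in> {x0..1} \<Longrightarrow> \<bar>f y\<bar> \<le> B" and g: "\<And>y. y \<in> {x0..1} \<Longrightarrow> \<bar>g y\<bar> \<le> B"
    and diff: "\<And>y. y \<in> {x0..1} \<Longrightarrow> \<bar>c_tau x0 T f * f y - c_tau x0 T g * g y\<bar> \<le> D"
  shows "\<bar>x powr (1 + \<alpha>) * (full_density x0 T f x - full_density x0 T g x)\<bar>
    \<le> D * (x0 powr (1 + \<alpha>) / \<beta> + const_M \<alpha> \<beta> (\<delta>0 x0) * (1 + \<alpha>))"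
proof -
  define y where "y = (\<lambda>n. T2_inv x0 T ((T1_inv x0 T ^^ (n - 1)) x))"
  define w where "w = (\<lambda>n. x powr (1 + \<alpha>) * branch_weight x n)"
  have w: "0 \<le> w n" for n by (simp add: w_def branch_weight_nonneg)
  have "x \<in> {0<..<1}" using x x0 by auto
  then have y: "y n \<in> {x0..1}" for n
    using T2_inv_in(1)[OF T1_inv_funpow_in, of x "n - 1"] by (simp add: y_def)
  have sw: "w summable_on {1..}"
    and iw: "infsum w {1..} \<le> x0 powr (1 + \<alpha>) / \<beta> + const_M \<alpha> \<beta> (\<delta>0 x0) * (1 + \<alpha>)"
    using branch_weight_infsum[OF x] by (simp_all add: w_def)
  have s: "(\<lambda>n. h (y n) * w n) summable_on {1..}" if "\<And>y. y \<in> {x0..1} \<Longrightarrow> \<bar>h y\<bar> \<le> B" for h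
  proof (rule abs_infsum_le(1))
    show "(\<lambda>n. B * w n) summable_on {1..}"
      by (rule summable_on_cmult_right[OF sw])
    show "\<bar>h (y n) * w n\<bar> \<le> B * w n" for n
      using that[OF y] w by (simp add: abs_mult mult_right_mono)
  qed
  have full: "x powr (1 + \<alpha>) * full_density x0 T h x = (\<Sum>\<^sub>\<infinity>n\<in>{1..}. c_tau x0 T h * (h (y n) * w n))" for h
    using x by (simp add: full_density_left y_def w_def mult_ac flip: infsum_cmult_right')
  have "x powr (1 + \<alpha>) * (full_density x0 T f x - full_density x0 T g x)
      = (\<Sum>\<^sub>\<infinity>n\<in>{1..}. (c_tau x0 T f * f (y n) - c_tau x0 T g * g (y n)) * w n)"
    unfolding right_diff_distrib full left_diff_distrib mult.assoc
    by (rule infsum_diff[symmetric]; intro summable_on_cmult_right s f g)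
  also have "\<bar>\<dots>\<bar> \<le> (\<Sum>\<^sub>\<infinity>n\<in>{1..}. D * w n)"
    by (rule abs_infsum_le(2)[OF summable_on_cmult_right[OF sw]])
      (use diff[OF y] w in \<open>simp add: abs_mult mult_right_mono\<close>)
  also have "\<dots> = D * infsum w {1..}"
    by (rule infsum_cmult_right')
  \<comment> \<open>Evaluating \<open>diff\<close> at a single point shows that \<open>D\<close> is
    nonnegative.\<close>
  also have "\<dots> \<le> D * (x0 powr (1 + \<alpha>) / \<beta> + const_M \<alpha> \<beta> (\<delta>0 x0) * (1 + \<alpha>))"
    using iw diff[OF y[of 1]] by (intro mult_left_mono) auto
  finally show ?thesis .
qed

section \<open>Return times\<close>

lemma x_seq_in: "x_seq x0 T n \<in> {0<..<1}"
  using T1_inv_funpow_in[of x0 n] x0 by (simp add: x_seq_def)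

lemma x_seq_Suc:
  shows "x_seq x0 T (Suc n) \<in> {0<..<x0}" and "T (x_seq x0 T (Suc n)) = x_seq x0 T n"
  using T1_inv_funpow_Suc[of x0 n] x0 by (simp_all add: x_seq_def)

lemma x_seq_0: "x_seq x0 T 0 = x0"
  by (simp add: x_seq_def)

lemma x_seq_decseq: "decseq (x_seq x0 T)"
  using T_left_gt[OF x_seq_Suc(1)] by (intro decseq_SucI) (simp add: x_seq_Suc(2) less_imp_le)

lemma x_seq_le:
  assumes "1 \<le> n"
  shows "x_seq x0 T n \<le> const_C1 \<alpha> * real n powr - (1 / \<alpha>)"
  using T1_inv_funpow_le[OF _ assms, of x0] x0 by (simp add: x_seq_def)

lemma x_seq_tendsto_0: "x_seq x0 T \<longlonglongrightarrow> 0"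
proof (rule tendsto_sandwich)
  show "\<forall>\<^sub>F n in sequentially. 0 \<le> x_seq x0 T n"
    using x_seq_in by (simp add: less_imp_le)
  show "\<forall>\<^sub>F n in sequentially. x_seq x0 T n \<le> const_C1 \<alpha> * real n powr - (1 / \<alpha>)"
    using x_seq_le by (auto simp: eventually_sequentially)
  have "(\<lambda>n. real n powr - (1 / \<alpha>)) \<longlonglongrightarrow> 0"
    using alpha by (intro tendsto_neg_powr filterlim_real_sequentially) simp
  then show "(\<lambda>n. const_C1 \<alpha> * real n powr - (1 / \<alpha>)) \<longlonglongrightarrow> 0"
    by (rule tendsto_mult_right_zero)
qed simp

text \<open>The gap is \<open>T z - z\<close> for \<open>z = x_seq x0 T j\<close>, which the
  expansion evaluates; the decay of \<open>z\<close> and the value of \<delta>0 at \<open>x0\<close>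
  bound the two factors.\<close>

lemma x_seq_length:
  assumes j: "1 \<le> j"
  shows "x_seq x0 T (j - 1) - x_seq x0 T j \<le> const_C2 \<alpha> x0 * real j powr - (1 + 1 / \<alpha>)"
proof -
  define z where "z = x_seq x0 T j"
  have z: "z \<in> {0<..<x0}" "T z = x_seq x0 T (j - 1)"
    using x_seq_Suc[of "j - 1"] j by (simp_all add: z_def)
  have "x_seq x0 T (j - 1) - x_seq x0 T j = z powr (1 + \<alpha>) * (1 + \<delta>0 z)"
    using T_left[OF z(1)] z by (simp add: z_def)
  also have "\<dots> \<le> (const_C1 \<alpha> * real j powr - (1 / \<alpha>)) powr (1 + \<alpha>) * ((1 - x0) / x0 powr (1 + \<alpha>))"
    using z(1) x_seq_le[OF j] delta0_nonneg[of z] delta0_mono[of z x0] delta0_x0 alpha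
    by (intro mult_mono powr_mono2) (auto simp: z_def)
  also have "(const_C1 \<alpha> * real j powr - (1 / \<alpha>)) powr (1 + \<alpha>)
      = const_C1 \<alpha> powr (1 + \<alpha>) * real j powr (- (1 / \<alpha>) * (1 + \<alpha>))"
    by (simp only: powr_mult powr_powr)
  also have "- (1 / \<alpha>) * (1 + \<alpha>) = - (1 + 1 / \<alpha>)"
    using alpha by (simp add: field_simps)
  also have "const_C1 \<alpha> powr (1 + \<alpha>)
      = 2 powr (1 / \<alpha> * (1 + \<alpha>)) * (2 powr (1 / \<alpha>) - 1) powr (1 / \<alpha> * (1 + \<alpha>))"
    by (simp only: const_C1_def powr_powr powr_mult)
  also have "1 / \<alpha> * (1 + \<alpha>) = 1 + 1 / \<alpha>"
    using alpha by (simp add: field_simps)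
  finally show ?thesis by (simp add: const_C2_def mult_ac)
qed

lemma W_subset: "W x0 T n \<subseteq> {x_seq x0 T n<..<(if n = 0 then 1 else x_seq x0 T (n - 1))}"
  by (simp add: W_def x_seq_0)

lemma W_disjoint:
  assumes "n < m"
  shows "W x0 T n \<inter> W x0 T m = {}"
proof -
  have "x_seq x0 T (m - 1) \<le> x_seq x0 T n"
    using decseqD[OF x_seq_decseq, of n "m - 1"] assms by simp
  then show ?thesis
    using W_subset[of n] W_subset[of m] assms by fastforce
qed

text \<open>The sequence tends to 0, so there is a least index whose point lies below
  \<open>v\<close>; that index names the interval.\<close>

lemma W_cover:
  assumes v: "v \<in> {0<..<1}" "v \<notin> range (x_seq x0 T)"
  shows "\<exists>n. v \<in> W x0 T n"
proof -
  have "\<forall>\<^sub>F n in sequentially. x_seq x0 T n < v"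
    using v by (intro order_tendstoD(2)[OF x_seq_tendsto_0]) auto
  then have ex: "\<exists>n. x_seq x0 T n < v"
    by (auto simp: eventually_sequentially)
  define n where "n = (LEAST n. x_seq x0 T n < v)"
  have n: "x_seq x0 T n < v"
    unfolding n_def by (rule LeastI_ex[OF ex])
  have "v \<in> W x0 T n"
  proof (cases "n = 0")
    case False
    then have "\<not> x_seq x0 T (n - 1) < v"
      unfolding n_def by (intro not_less_Least) simp
    moreover have "v \<noteq> x_seq x0 T (n - 1)"
      using v(2) by blast
    ultimately show ?thesis
      using n False by (simp add: W_def)
  qed (use n v in \<open>simp add: W_def x_seq_0\<close>)
  then show ?thesis by blast
qed

lemma sets_preimage_right: "{y \<in> {x0..1}. T y \<in> {a<..<b}} \<in> sets (hat_lambda x0)"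
proof -
  have "openin (top_of_set {x0..1}) ({x0..1} \<inter> T -` {a<..<b})"
    using T_right_continuous by (rule continuous_openin_preimage_gen) simp
  then obtain U where "open U" "{x0..1} \<inter> T -` {a<..<b} = {x0..1} \<inter> U"
    unfolding openin_open by blast
  then have "{x0..1} \<inter> T -` {a<..<b} \<in> sets lebesgue"
    by auto
  moreover have "{y \<in> {x0..1}. T y \<in> {a<..<b}} = {x0..1} \<inter> T -` {a<..<b}"
    by blast
  ultimately show ?thesis
    by (simp add: sets_hat_lambda[OF x0(2)])
qed

text \<open>Expansion bounds the diameter of the preimage by \<open>(b - a) / \<beta>\<close>; the
  factor \<open>1 - x0\<close> is the normalization.\<close>

lemma measure_preimage_right_le:
  assumes ab: "a \<le> b"
  shows "measure (hat_lambda x0) {y \<in> {x0..1}. T y \<in> {a<..<b}} \<le> (b - a) / (\<beta> * (1 - x0))"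
    (is "measure _ ?S \<le> _")
proof -
  have S: "?S \<subseteq> {x0..1}" "?S \<in> sets lebesgue"
    using sets_preimage_right by (auto simp: sets_hat_lambda[OF x0(2)])
  have "measure lebesgue ?S \<le> (b - a) / \<beta>"
  proof (rule measure_lebesgue_le_diameter[OF S(2)])
    fix x y assume "x \<in> ?S" "y \<in> ?S"
    then have "\<beta> * \<bar>x - y\<bar> \<le> \<bar>T x - T y\<bar>" "\<bar>T x - T y\<bar> \<le> b - a"
      using T_right_expanding[of x y] by auto
    then show "\<bar>x - y\<bar> \<le> (b - a) / \<beta>"
      using beta by (simp add: pos_le_divide_eq mult.commute)
  qed (use ab beta in simp)
  then have "measure lebesgue ?S / (1 - x0) \<le> (b - a) / \<beta> / (1 - x0)"
    using x0 by (intro divide_right_mono) auto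
  then show ?thesis
    unfolding measure_hat_lambda[OF x0(2) S] by (simp only: divide_divide_eq_left)
qed

lemma sets_Z: "Z x0 T k \<in> sets (hat_lambda x0)"
  by (simp add: Z_def W_def sets_preimage_right[simplified])

lemma measure_Z_1_le: "measure (hat_lambda x0) (Z x0 T 1) \<le> 1 / \<beta>"
  using measure_preimage_right_le[of x0 1] x0 by (simp add: Z_def W_def)

lemma measure_Z_Suc_le:
  assumes j: "1 \<le> j"
  shows "measure (hat_lambda x0) (Z x0 T (Suc j))
    \<le> const_C2 \<alpha> x0 / (\<beta> * (1 - x0)) * real j powr - (1 + 1 / \<alpha>)"
proof -
  have "x_seq x0 T j \<le> x_seq x0 T (j - 1)"
    by (rule decseqD[OF x_seq_decseq]) simp
  then have "measure (hat_lambda x0) (Z x0 T (Suc j))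
      \<le> (x_seq x0 T (j - 1) - x_seq x0 T j) / (\<beta> * (1 - x0))"
    using measure_preimage_right_le[of "x_seq x0 T j" "x_seq x0 T (j - 1)"] j by (simp add: Z_def W_def)
  also have "\<dots> \<le> const_C2 \<alpha> x0 * real j powr - (1 + 1 / \<alpha>) / (\<beta> * (1 - x0))"
    using x_seq_length[OF j] x0 beta by (intro divide_right_mono) auto
  finally show ?thesis by simp
qed

text \<open>With \<open>p = 1 / \<alpha>\<close>, the product of the return time
  \<open>j + 1\<close> and \<open>j powr - (1 + p)\<close> splits into powers \<open>- p\<close> and
  \<open>- (1 + p)\<close> of \<open>j\<close>. Both sums converge because \<open>p > 1\<close>,
  that is \<open>\<alpha> < 1\<close>.\<close>

lemma return_time_infsum:
  shows "(\<lambda>k. real k * measure (hat_lambda x0) (Z x0 T k)) summable_on {1..}" (is "?g summable_on _")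
    and "(\<Sum>\<^sub>\<infinity>k\<in>{1..}. real k * measure (hat_lambda x0) (Z x0 T k)) \<le> const_C3 \<alpha> x0 \<beta>"
proof -
  define C where "C = const_C2 \<alpha> x0 / (\<beta> * (1 - x0))"
  define p where "p = 1 / \<alpha>"
  have C: "0 \<le> C"
    using x0 beta by (simp add: C_def const_C2_def)
  have p: "1 < p" "1 / (p - 1) = \<alpha> / (1 - \<alpha>)" "1 / p = \<alpha>"
    using alpha by (simp_all add: p_def field_simps)
  have C3: "const_C3 \<alpha> x0 \<beta> = 1 / \<beta> + C * (\<alpha> + (2 - \<alpha>) / (1 - \<alpha>))"
    by (simp add: const_C3_def C_def)
  have le: "(\<Sum>k=1..N. ?g k) \<le> const_C3 \<alpha> x0 \<beta>" for N
  proof (cases N)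
    case 0
    have "0 \<le> const_C3 \<alpha> x0 \<beta>"
      using C alpha beta by (auto simp: C3 intro!: add_nonneg_nonneg mult_nonneg_nonneg)
    then show ?thesis using 0 by simp
  next
    case (Suc N')
    have "(\<Sum>k=1..N. ?g k) = ?g 1 + (\<Sum>j=1..N'. ?g (Suc j))"
      unfolding Suc by (subst sum.atLeast_Suc_atMost) (simp_all add: sum.shift_bounds_cl_Suc_ivl del: sum.cl_ivl_Suc)
    also have "\<dots> \<le> 1 / \<beta> + (\<Sum>j=1..N'. C * (real j powr - p + real j powr - (1 + p)))"
    proof (intro add_mono sum_mono)
      show "?g 1 \<le> 1 / \<beta>" using measure_Z_1_le by simp
      fix j assume "j \<in> {1..N'}"
      then have j: "1 \<le> j" by simp
      have "?g (Suc j) \<le> real (Suc j) * (C * real j powr - (1 + p))"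
        using measure_Z_Suc_le[OF j] by (intro mult_left_mono) (auto simp: C_def p_def)
      also have "\<dots> = C * (real j * real j powr - (1 + p) + real j powr - (1 + p))"
        by (simp add: algebra_simps)
      also have "real j * real j powr - (1 + p) = real j powr - p"
        using j by (simp add: powr_mult_base)
      finally show "?g (Suc j) \<le> C * (real j powr - p + real j powr - (1 + p))" .
    qed
    also have "\<dots> = 1 / \<beta> + C * ((\<Sum>j=1..N'. real j powr - p) + (\<Sum>j=1..N'. real j powr - (1 + p)))"
      by (simp add: distrib_left sum.distrib flip: sum_distrib_left)
    also have "\<dots> \<le> 1 / \<beta> + C * ((1 + \<alpha> / (1 - \<alpha>)) + (1 + \<alpha>))"
      using sum_powr_le[of p N'] sum_powr_le[of "1 + p" N'] p C
      by (intro add_left_mono mult_left_mono add_mono) auto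
    also have "(1 + \<alpha> / (1 - \<alpha>)) + (1 + \<alpha>) = \<alpha> + (2 - \<alpha>) / (1 - \<alpha>)"
      using alpha by (simp add: field_simps)
    finally show ?thesis by (simp add: C3)
  qed
  have nonneg: "0 \<le> ?g n" for n by simp
  from nonneg_infsum_atLeast_1[OF nonneg le]
  show "?g summable_on {1..}" "infsum ?g {1..} \<le> const_C3 \<alpha> x0 \<beta>" by blast+
qed

lemma const_C3_nonneg: "0 \<le> const_C3 \<alpha> x0 \<beta>"
  using return_time_infsum(2) infsum_nonneg[of "{1..}" "\<lambda>k. real k * measure (hat_lambda x0) (Z x0 T k)"]
  by simp

text \<open>The shift by \<open>Suc\<close> matters: natural subtraction makes
  \<open>Z x0 T 0\<close> coincide with \<open>Z x0 T 1\<close>.\<close>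

lemma Z_disjoint: "disjoint_family (\<lambda>i. Z x0 T (Suc i))"
proof -
  have "Z x0 T (Suc i) \<inter> Z x0 T (Suc j) = {}" if "i < j" for i j
    using W_disjoint[OF that] by (auto simp: Z_def)
  then show ?thesis
    unfolding disjoint_family_on_def by (metis inf_commute linorder_neqE_nat)
qed

text \<open>The exceptional points are mapped to 0, 1 or some \<open>x_seq x0 T n\<close>; as
  \<open>T\<close> is injective on \<open>{x0..1}\<close>, they form a countable set.\<close>

lemma AE_Z: "AE y in hat_lambda x0. y \<in> (\<Union>i. Z x0 T (Suc i))"
proof -
  define N where "N = {x0..1} \<inter> T -` ({0, 1} \<union> range (x_seq x0 T))"
  have "countable N"
    unfolding N_def by (intro countable_image_inj_Int_vimage T_right_inj) auto
  then have "N \<in> null_sets lebesgue"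
    using countable_imp_null_set_lborel null_sets_completionI by blast
  then have "AE y in lebesgue. y \<notin> N"
    by (rule AE_not_in)
  then have "AE y in lebesgue. y \<in> {x0..1} \<longrightarrow> y \<in> (\<Union>i. Z x0 T (Suc i))"
  proof eventually_elim
    case (elim y)
    show ?case
    proof
      assume y: "y \<in> {x0..1}"
      then have "T y \<in> {0<..<1}" "T y \<notin> range (x_seq x0 T)"
        using elim T_right_in[OF y] by (auto simp: N_def)
      then obtain n where "T y \<in> W x0 T n"
        using W_cover by blast
      then show "y \<in> (\<Union>i. Z x0 T (Suc i))"
        using y by (auto simp: Z_def)
    qed
  qed
  then show ?thesis
    by (simp add: AE_hat_lambda[OF x0(2)] AE_restrict_space_iff)
qed

section \<open>Dependence of the normalizing constant on the density\<close>

text \<open>The mean return time to \<open>Delta x0\<close> under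
  \<open>hat_mu x0 f\<close>.\<close>

definition return_sum :: "(real \<Rightarrow> real) \<Rightarrow> real" where
  "return_sum f = (\<Sum>\<^sub>\<infinity>k\<in>{1..}. real k * measure (hat_mu x0 f) (Z x0 T k))"

lemma c_tau_eq: "c_tau x0 T f = 1 / return_sum f"
  by (simp add: c_tau_def return_sum_def inverse_eq_divide)

text \<open>Each term is dominated by \<epsilon> times the corresponding term for Lebesgue measure.
  Summability is asserted for the difference, so that the zero density may be inserted for
  \<open>g\<close> to get summability of a single series.\<close>

lemma return_sum_diff:
  assumes f: "continuous_on {x0..1} f" "\<forall>x\<in>{x0..1}. 0 \<le> f x"
    and g: "continuous_on {x0..1} g" "\<forall>x\<in>{x0..1}. 0 \<le> g x"
    and le: "\<And>x. x \<in> {x0..1} \<Longrightarrow> \<bar>f x - g x\<bar> \<le> \<epsilon>"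
  shows "(\<lambda>k. real k * measure (hat_mu x0 f) (Z x0 T k)
      - real k * measure (hat_mu x0 g) (Z x0 T k)) summable_on {1..}" (is "?s summable_on _")
    and "\<bar>\<Sum>\<^sub>\<infinity>k\<in>{1..}. real k * measure (hat_mu x0 f) (Z x0 T k)
      - real k * measure (hat_mu x0 g) (Z x0 T k)\<bar> \<le> \<epsilon> * const_C3 \<alpha> x0 \<beta>"
proof -
  have s: "(\<lambda>k. \<epsilon> * (real k * measure (hat_lambda x0) (Z x0 T k))) summable_on {1..}"
    by (rule summable_on_cmult_right[OF return_time_infsum(1)])
  have b: "\<bar>?s k\<bar> \<le> \<epsilon> * (real k * measure (hat_lambda x0) (Z x0 T k))" for k
  proof -
    have "\<bar>?s k\<bar> = real k * \<bar>measure (hat_mu x0 f) (Z x0 T k) - measure (hat_mu x0 g) (Z x0 T k)\<bar>"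
      by (simp add: abs_mult flip: right_diff_distrib)
    also have "\<dots> \<le> real k * (\<epsilon> * measure (hat_lambda x0) (Z x0 T k))"
      using measure_hat_mu_diff[OF x0(2) f g le sets_Z] by (intro mult_left_mono) auto
    finally show ?thesis by (simp add: mult_ac)
  qed
  show "?s summable_on {1..}"
    by (rule abs_infsum_le(1)[OF s b])
  have "\<bar>infsum ?s {1..}\<bar> \<le> (\<Sum>\<^sub>\<infinity>k\<in>{1..}. \<epsilon> * (real k * measure (hat_lambda x0) (Z x0 T k)))"
    by (rule abs_infsum_le(2)[OF s b])
  also have "\<dots> = \<epsilon> * (\<Sum>\<^sub>\<infinity>k\<in>{1..}. real k * measure (hat_lambda x0) (Z x0 T k))"
    by (rule infsum_cmult_right')
  also have "\<dots> \<le> \<epsilon> * const_C3 \<alpha> x0 \<beta>"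
    using return_time_infsum(2) le[of x0] x0 by (intro mult_left_mono) auto
  finally show "\<bar>infsum ?s {1..}\<bar> \<le> \<epsilon> * const_C3 \<alpha> x0 \<beta>" .
qed

lemma return_summable:
  assumes f: "continuous_on {x0..1} f" "\<forall>x\<in>{x0..1}. 0 \<le> f x"
  shows "(\<lambda>k. real k * measure (hat_mu x0 f) (Z x0 T k)) summable_on {1..}"
proof -
  have "compact {x0..1}" "{x0..1} \<noteq> {}" using x0 by auto
  then obtain y where "\<And>x. x \<in> {x0..1} \<Longrightarrow> f x \<le> f y"
    using continuous_attains_sup[OF _ _ f(1)] by blast
  then have "\<bar>f x - 0\<bar> \<le> f y" if "x \<in> {x0..1}" for x
    using f(2) that by auto
  from return_sum_diff(1)[OF f _ _ this]
  have "(\<lambda>k. real k * measure (hat_mu x0 f) (Z x0 T k)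
      - real k * measure (hat_mu x0 (\<lambda>_. 0)) (Z x0 T k)) summable_on {1..}"
    by simp
  moreover have "measure (hat_mu x0 (\<lambda>_. 0)) (Z x0 T k) = 0" for k
    by (subst measure_hat_mu[OF x0(2) _ _ sets_Z]) auto
  ultimately show ?thesis by simp
qed

text \<open>Every return time is at least 1, and the sets \<open>Z\<close> carry the whole mass 1 of
  \<open>hat_mu x0 f\<close>.\<close>

lemma return_sum_ge_1:
  assumes f: "continuous_on {x0..1} f" "\<forall>x\<in>{x0..1}. 0 \<le> f x"
    and int: "(LINT x|hat_lambda x0. f x) = 1"
  shows "1 \<le> return_sum f"
proof -
  let ?\<mu> = "measure (hat_mu x0 f)" and ?U = "\<Union>i. Z x0 T (Suc i)"
  have U: "?U \<in> sets (hat_lambda x0)"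
    using sets_Z by auto
  have "emeasure (hat_mu x0 f) (space (hat_mu x0 f)) \<noteq> \<infinity>"
    using emeasure_hat_mu[OF x0(2) f, of "{x0..1}"]
    by (simp add: hat_mu_def space_hat_lambda[OF x0(2)] sets_hat_lambda[OF x0(2)])
  then interpret finite_measure "hat_mu x0 f"
    by (rule finite_measureI)
  have "?\<mu> ?U = (LINT x|hat_lambda x0. f x * indicator ?U x)"
    by (rule measure_hat_mu[OF x0(2) f U])
  also have "\<dots> = (LINT x|hat_lambda x0. f x)"
  proof (rule integral_cong_AE)
    show "AE x in hat_lambda x0. f x * indicator ?U x = f x"
      using AE_Z by eventually_elim simp
    show "(\<lambda>x. f x * indicator ?U x) \<in> borel_measurable (hat_lambda x0)"
      using integrable_hat_lambda_indicator[OF x0(2) f(1) U] by (rule borel_measurable_integrable)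
  qed (rule measurable_hat_lambda[OF x0(2) f(1)])
  finally have "?\<mu> ?U = 1" using int by simp
  moreover have "(\<lambda>i. ?\<mu> (Z x0 T (Suc i))) sums ?\<mu> ?U"
    using sets_Z by (intro finite_measure_UNION Z_disjoint) (auto simp: hat_mu_def)
  ultimately have lim: "(\<lambda>n. \<Sum>i<n. ?\<mu> (Z x0 T (Suc i))) \<longlonglongrightarrow> 1"
    by (simp add: sums_def)
  show ?thesis
  proof (rule LIMSEQ_le_const2[OF lim], intro exI allI impI)
    fix n
    have "(\<Sum>i<n. ?\<mu> (Z x0 T (Suc i))) \<le> (\<Sum>i<n. real (Suc i) * ?\<mu> (Z x0 T (Suc i)))"
      by (intro sum_mono) (simp add: algebra_simps)
    also have "\<dots> = (\<Sum>k\<in>Suc ` {..<n}. real k * ?\<mu> (Z x0 T k))"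
      by (subst sum.reindex) auto
    also have "\<dots> \<le> return_sum f"
      unfolding return_sum_def
      by (rule finite_sum_le_infsum[OF return_summable[OF f]]) auto
    finally show "(\<Sum>i<n. ?\<mu> (Z x0 T (Suc i))) \<le> return_sum f" .
  qed
qed

text \<open>The reciprocal is Lipschitz with constant 1 on numbers that are at least 1, and both
  mean return times are.\<close>

lemma c_tau_diff:
  assumes f: "continuous_on {x0..1} f" "\<forall>x\<in>{x0..1}. 0 \<le> f x" "(LINT x|hat_lambda x0. f x) = 1"
    and g: "continuous_on {x0..1} g" "\<forall>x\<in>{x0..1}. 0 \<le> g x" "(LINT x|hat_lambda x0. g x) = 1"
    and le: "\<And>x. x \<in> {x0..1} \<Longrightarrow> \<bar>f x - g x\<bar> \<le> \<epsilon>"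
  shows "\<bar>c_tau x0 T f - c_tau x0 T g\<bar> \<le> \<epsilon> * const_C3 \<alpha> x0 \<beta>"
proof -
  have S: "1 \<le> return_sum f" "1 \<le> return_sum g"
    using return_sum_ge_1 f g by blast+
  have "return_sum f - return_sum g = (\<Sum>\<^sub>\<infinity>k\<in>{1..}. real k * measure (hat_mu x0 f) (Z x0 T k)
      - real k * measure (hat_mu x0 g) (Z x0 T k))"
    unfolding return_sum_def by (rule infsum_diff[symmetric]) (rule return_summable f g)+
  then have diff: "\<bar>return_sum f - return_sum g\<bar> \<le> \<epsilon> * const_C3 \<alpha> x0 \<beta>"
    using return_sum_diff(2)[OF f(1,2) g(1,2) le] by simp
  have "c_tau x0 T f - c_tau x0 T g = (return_sum g - return_sum f) / (return_sum f * return_sum g)"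
    using S by (simp add: c_tau_eq field_simps)
  then have "\<bar>c_tau x0 T f - c_tau x0 T g\<bar>
      = \<bar>return_sum f - return_sum g\<bar> / (return_sum f * return_sum g)"
    using S by (simp add: abs_mult abs_minus_commute)
  also have "\<dots> \<le> \<bar>return_sum f - return_sum g\<bar> / 1"
  proof (rule divide_left_mono)
    show "1 \<le> return_sum f * return_sum g"
      using mult_mono[OF S] S by simp
  qed (use S in auto)
  finally show ?thesis using diff by simp
qed

section \<open>Comparison of the densities on the whole interval\<close>

lemma density_diff_le:
  assumes f: "continuous_on {x0..1} f" "\<forall>x\<in>{x0..1}. 0 \<le> f x" "(LINT x|hat_lambda x0. f x) = 1"
    and g: "continuous_on {x0..1} g" "\<forall>x\<in>{x0..1}. 0 \<le> g x" "(LINT x|hat_lambda x0. g x) = 1"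
    and le: "\<And>x. x \<in> {x0..1} \<Longrightarrow> \<bar>f x - g x\<bar> \<le> \<epsilon>"
    and F: "\<And>x. x \<in> {x0..1} \<Longrightarrow> f x \<le> F"
    and y: "y \<in> {x0..1}"
  shows "\<bar>c_tau x0 T f * f y - c_tau x0 T g * g y\<bar> \<le> \<epsilon> * (1 + const_C3 \<alpha> x0 \<beta> * F)"
proof -
  have \<epsilon>: "0 \<le> \<epsilon>" using le[OF y] by linarith
  have "1 \<le> return_sum g" by (rule return_sum_ge_1[OF g])
  then have c: "0 \<le> c_tau x0 T g" "c_tau x0 T g \<le> 1"
    by (simp_all add: c_tau_eq)
  \<comment> \<open>With this splitting only \<open>f\<close> needs the supremum bound
    \<open>F\<close>; the factor in front of \<open>f y - g y\<close> is at most 1.\<close>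
  have eq: "c_tau x0 T f * f y - c_tau x0 T g * g y
      = c_tau x0 T g * (f y - g y) + (c_tau x0 T f - c_tau x0 T g) * f y"
    by (simp add: algebra_simps)
  have "\<bar>c_tau x0 T f * f y - c_tau x0 T g * g y\<bar>
      \<le> \<bar>c_tau x0 T g * (f y - g y)\<bar> + \<bar>(c_tau x0 T f - c_tau x0 T g) * f y\<bar>"
    unfolding eq by (rule abs_triangle_ineq)
  also have "\<dots> = c_tau x0 T g * \<bar>f y - g y\<bar> + \<bar>c_tau x0 T f - c_tau x0 T g\<bar> * f y"
    using c f(2) y by (simp add: abs_mult)
  also have "\<dots> \<le> 1 * \<epsilon> + \<epsilon> * const_C3 \<alpha> x0 \<beta> * F"
    using c c_tau_diff[OF f g le] le[OF y] F[OF y] f(2) y \<epsilon> const_C3_nonneg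
    by (intro add_mono mult_mono) auto
  finally show ?thesis by (simp add: algebra_simps)
qed

text \<open>To the right of \<open>x0\<close> the weight is at most 1 and the error at most
  \<open>D\<close>; to the left the series contributes \<open>D * R\<close>. Both are at most
  \<open>D * (1 + R)\<close>.\<close>

lemma full_density_B_norm_le:
  assumes f: "continuous_on {x0..1} f" "\<forall>x\<in>{x0..1}. 0 \<le> f x" "(LINT x|hat_lambda x0. f x) = 1"
    and g: "continuous_on {x0..1} g" "\<forall>x\<in>{x0..1}. 0 \<le> g x" "(LINT x|hat_lambda x0. g x) = 1"
    and le: "\<And>x. x \<in> {x0..1} \<Longrightarrow> \<bar>f x - g x\<bar> \<le> \<epsilon>"
    and F: "\<And>x. x \<in> {x0..1} \<Longrightarrow> f x \<le> F"
  shows "B_norm \<alpha> (\<lambda>x. full_density x0 T f x - full_density x0 T g x)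
    \<le> ereal (\<epsilon> * (1 + x0 powr (1 + \<alpha>) / \<beta> + const_M \<alpha> \<beta> (\<delta>0 x0) * (1 + \<alpha>))
        * (1 + const_C3 \<alpha> x0 \<beta> * F))"
  unfolding B_norm_def
proof (rule SUP_least)
  fix x :: real assume x: "x \<in> {0<..1}"
  define D where "D = \<epsilon> * (1 + const_C3 \<alpha> x0 \<beta> * F)"
  define R where "R = x0 powr (1 + \<alpha>) / \<beta> + const_M \<alpha> \<beta> (\<delta>0 x0) * (1 + \<alpha>)"
  have D: "\<bar>c_tau x0 T f * f y - c_tau x0 T g * g y\<bar> \<le> D" if "y \<in> {x0..1}" for y
    unfolding D_def by (rule density_diff_le[OF f g le F that])
  have D0: "0 \<le> D" using D[of x0] x0 by auto
  have R0: "0 \<le> R"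
    using const_M_nonneg alpha beta by (auto simp: R_def)
  have "\<bar>x powr (1 + \<alpha>) * (full_density x0 T f x - full_density x0 T g x)\<bar> \<le> D * (1 + R)"
  proof (cases "x < x0")
    case True
    have "\<bar>x powr (1 + \<alpha>) * (full_density x0 T f x - full_density x0 T g x)\<bar> \<le> D * R"
      unfolding R_def
    proof (rule full_density_diff_left[OF _ _ _ D])
      show "\<bar>f y\<bar> \<le> F + \<epsilon>" "\<bar>g y\<bar> \<le> F + \<epsilon>" if "y \<in> {x0..1}" for y
        using f(2) g(2) F[OF that] le[OF that] that by auto
    qed (use x True in auto)
    also have "\<dots> \<le> D * (1 + R)"
      using D0 by (intro mult_left_mono) auto
    finally show ?thesis .
  next
    case False
    then have xD: "x \<in> {x0..1}" using x by simp
    have "\<bar>x powr (1 + \<alpha>) * (full_density x0 T f x - full_density x0 T g x)\<bar>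
        = x powr (1 + \<alpha>) * \<bar>c_tau x0 T f * f x - c_tau x0 T g * g x\<bar>"
      using xD by (simp add: full_density_def abs_mult)
    also have "\<dots> \<le> 1 * (D * (1 + R))"
    proof (intro mult_mono)
      show "x powr (1 + \<alpha>) \<le> 1"
        using x alpha by (intro powr_le1) auto
      have "D * 1 \<le> D * (1 + R)"
        using D0 R0 by (intro mult_left_mono) auto
      then show "\<bar>c_tau x0 T f * f x - c_tau x0 T g * g x\<bar> \<le> D * (1 + R)"
        using D[OF xD] by simp
    qed auto
    finally show ?thesis by simp
  qed
  also have "D * (1 + R) = \<epsilon> * (1 + x0 powr (1 + \<alpha>) / \<beta> + const_M \<alpha> \<beta> (\<delta>0 x0) * (1 + \<alpha>))
        * (1 + const_C3 \<alpha> x0 \<beta> * F)"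
    by (simp add: D_def R_def add.assoc mult_ac)
  finally show "ereal \<bar>x powr (1 + \<alpha>) * (full_density x0 T f x - full_density x0 T g x)\<bar>
    \<le> ereal (\<epsilon> * (1 + x0 powr (1 + \<alpha>) / \<beta> + const_M \<alpha> \<beta> (\<delta>0 x0) * (1 + \<alpha>))
        * (1 + const_C3 \<alpha> x0 \<beta> * F))"
    by simp
qed

end

theorem theorem3p1:
  fixes \<alpha> x0 \<beta> \<gamma> C\<^sub>L\<^sub>Y C_hat :: real
    and T T1 \<delta>0 \<delta>1 :: "real \<Rightarrow> real"
    and f_hat :: "real \<Rightarrow> real"
    and f_hat_m :: "nat \<Rightarrow> real \<Rightarrow> real"
    and m0 :: nat
  assumes "neutral_map \<alpha> x0 \<beta> T T1 \<delta>0 \<delta>1"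
    and "hat_invariant_density x0 T f_hat"
    and "\<exists>L. L-lipschitz_on (Delta x0) f_hat"
    and "\<And>m. m \<ge> 1 \<Longrightarrow> discrete_invariant_density x0 T m (f_hat_m m)"
    and "\<gamma> < 1"
    and "\<And>x. x \<in> hat_dom x0 T \<Longrightarrow> 1 / \<bar>deriv (hat_T x0 T) x\<bar> \<le> \<gamma>"
    and "C\<^sub>L\<^sub>Y > 0"
    and "\<And>f. f \<in> BV_on (Delta x0) \<Longrightarrow>
           variation_on (Delta x0) (hat_L x0 T f)
             \<le> ereal \<gamma> * variation_on (Delta x0) f + ereal (C\<^sub>L\<^sub>Y * L1_norm_on (Delta x0) f)"
    and "m0 \<ge> 1"
    and "\<And>m. m \<ge> m0 \<Longrightarrow>
           sup_norm_on (Delta x0) (\<lambda>x. f_hat x - f_hat_m m x) \<le> ereal (C_hat * (ln (real m) / real m))"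
  shows "\<forall>m\<ge>m0.
           B_norm \<alpha> (\<lambda>x. full_density x0 T f_hat x - full_density x0 T (f_hat_m m) x)
             \<le> ereal (const_C_star \<alpha> x0 \<beta> (\<delta>0 x0) \<gamma> C\<^sub>L\<^sub>Y C_hat * (ln (real m) / real m))"
proof (intro allI impI)
  fix m assume m: "m \<ge> m0"
  interpret neutral_map \<alpha> x0 \<beta> T T1 \<delta>0 \<delta>1 by fact
  define \<epsilon> where "\<epsilon> = C_hat * (ln (real m) / real m)"
  obtain L where L: "L-lipschitz_on {x0..1} f_hat" using assms(3) by blast
  have f: "continuous_on {x0..1} f_hat" "\<forall>x\<in>{x0..1}. 0 \<le> f_hat x" "(LINT x|hat_lambda x0. f_hat x) = 1"
    using lipschitz_on_continuous_on[OF L] assms(2) by (auto simp: hat_invariant_density_def)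
  have inv: "discrete_invariant_density x0 T m (f_hat_m m)"
    using assms(4,9) m by simp
  have g: "continuous_on {x0..1} (f_hat_m m)" "\<forall>x\<in>{x0..1}. 0 \<le> f_hat_m m x"
      "(LINT x|hat_lambda x0. f_hat_m m x) = 1"
    using discrete_density_continuous[OF inv] inv by (auto simp: discrete_invariant_density_def)
  have le: "\<bar>f_hat x - f_hat_m m x\<bar> \<le> \<epsilon>" if "x \<in> {x0..1}" for x
  proof -
    have "ereal \<bar>f_hat x - f_hat_m m x\<bar> \<le> sup_norm_on {x0..1} (\<lambda>x. f_hat x - f_hat_m m x)"
      unfolding sup_norm_on_def using that by (rule SUP_upper)
    also have "\<dots> \<le> ereal \<epsilon>"
      unfolding \<epsilon>_def by (rule assms(10)[OF m])
    finally show ?thesis by simp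
  qed
  have F: "f_hat x \<le> C\<^sub>L\<^sub>Y / (1 - \<gamma>) + 1 / (1 - x0)" if "x \<in> {x0..1}" for x
  proof -
    have "f_hat x \<le> 1 + C\<^sub>L\<^sub>Y * (1 - x0) / (1 - \<gamma>)"
      by (rule invariant_density_le[OF x0(2) assms(2) L assms(5) assms(8) that])
    \<comment> \<open>Weakening by \<open>0 < 1 - x0 < 1\<close> to the expression that occurs in
      \<open>const_C4\<close>.\<close>
    also have "\<dots> \<le> 1 / (1 - x0) + C\<^sub>L\<^sub>Y * 1 / (1 - \<gamma>)"
      using x0 assms(5,7) by (intro add_mono divide_right_mono mult_left_mono) auto
    finally show ?thesis by simp
  qed
  have "B_norm \<alpha> (\<lambda>x. full_density x0 T f_hat x - full_density x0 T (f_hat_m m) x)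
    \<le> ereal (\<epsilon> * (1 + x0 powr (1 + \<alpha>) / \<beta> + const_M \<alpha> \<beta> (\<delta>0 x0) * (1 + \<alpha>))
        * (1 + const_C3 \<alpha> x0 \<beta> * (C\<^sub>L\<^sub>Y / (1 - \<gamma>) + 1 / (1 - x0))))"
    by (rule full_density_B_norm_le[OF f g le F])
  also have "\<epsilon> * (1 + x0 powr (1 + \<alpha>) / \<beta> + const_M \<alpha> \<beta> (\<delta>0 x0) * (1 + \<alpha>))
        * (1 + const_C3 \<alpha> x0 \<beta> * (C\<^sub>L\<^sub>Y / (1 - \<gamma>) + 1 / (1 - x0)))
      = const_C_star \<alpha> x0 \<beta> (\<delta>0 x0) \<gamma> C\<^sub>L\<^sub>Y C_hat * (ln (real m) / real m)"
    by (simp only: const_C_star_def const_C4_def \<epsilon>_def mult_ac)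
  finally show "B_norm \<alpha> (\<lambda>x. full_density x0 T f_hat x - full_density x0 T (f_hat_m m) x)
             \<le> ereal (const_C_star \<alpha> x0 \<beta> (\<delta>0 x0) \<gamma> C\<^sub>L\<^sub>Y C_hat * (ln (real m) / real m))" .
qed

end
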